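(* Let $n\ge2$ and consider the Cuntz algebra $\mathcal{O}_n$ as the graph $C^*$-algebra of the graph $\Lambda$ with one vertex $v$ and $n$ loops $e_1,\dots,e_n$. The action $\alpha:\mathcal{O}_n\to\mathcal{O}_n\otimes C(U_n^+)$ of the quantum unitary group $U_n^+$ given by $$\alpha(S_{e_i})=\sum_{j=1}^nS_{e_j}\otimes q_{ji},\qquad 1\le i\le n,$$ is not isometric with respect to the spectral triple $(\mathcal{O}_n,L^2(\Lambda^\infty,M),D)$. That is, there is no unitary co-representation $\widetilde U$ of $U_n^+$ on $L^2(\Lambda^\infty,M)$ which both implements $\alpha$ on the spectral data and satisfies $\widetilde U\circ(D\otimes1)=(D\otimes1)\circ\widetilde U$ on appropriate domains.
   Context: $\mathcal{O}_n$ is the universal unital $C^*$-algebra generated by $S_{e_1},\dots,S_{e_n}$ with $S_{e_i}^*S_{e_i}=1=\sum_jS_{e_j}S_{e_j}^*$. A compact quantum group (CQG) $\mathbb{G}$ is a pair $(C(\mathbb{G}),\Delta)$ of a unital $C^*$-algebra and a coassociative unital $*$-homomorphism $\Delta:C(\mathbb{G})\to C(\mathbb{G})\otimes C(\mathbb{G})$ (minimal tensor product) such that the linear spans of $\Delta(C(\mathbb{G}))(1\otimes C(\mathbb{G}))$ and $\Delta(C(\mathbb{G}))(C(\mathbb{G})\otimes1)$ are dense. $C(U_n^+)$ is the universal $C^*$-algebra generated by $q_{ij}$, $1\le i,j\le n$, such that $q=(q_{ij})$ and $\overline q=(q_{ij}^* )$ are unitary matrices, with $\Delta(q_{ij})=\sum_kq_{ik}\otimes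 q_{kj}$. It is known that the formula for $\alpha$ defines an action. Spectral triple. Finite paths are words $\lambda=\lambda_1\cdots\lambda_k$ in $\{e_1,\dots,e_n\}$ with length $d(\lambda)=k$; the length-$0$ path is $v$. $\Lambda^\infty$ is the space of infinite words with the product topology, $[\lambda]$ is the cylinder set of infinite words beginning with $\lambda$ ($[v]=\Lambda^\infty$), and $M$ is the Borel probability measure with $M([\lambda])=n^{-d(\lambda)}$. Put $\mathcal{H}=L^2(\Lambda^\infty,M)$. The representation $\pi:\mathcal{O}_n\to\mathcal{B}(\mathcal{H})$ is given by $\pi(S_\lambda)\chi_{[\eta]}=n^{d(\lambda)/2}\chi_{[\lambda\eta]}$, where $S_\lambda=S_{\lambda_1}\cdots S_{\lambda_k}$. $\mathcal{R}_{-1}$ is the space of constant functions, $\mathcal{R}_k=\mathrm{Sp}\{\chi_{[\eta]}:d(\eta)\le k\}$ for $k\in\mathbb{N}=\{0,1,2,\dots\}$, $\Xi_k$ is the orthogonal projection onto $\mathcal{R}_k$, and $D=\sum_{q\in\mathbb{N}}\alpha_q(\Xi_q-\Xi_{q-1})$, where $(\alpha_q)$ is an increasing sequence of positive reals with $\alpha_q\to\infty$ and $\sup_q|\alpha_{q+1}-\alpha_q|<\infty$. Isometric actions. A unitary co-representation of $\mathbb{G}$ on $\mathcal{H}$ is a unitary $\widetilde U\in\mathcal{M}(\mathcal{K}(\mathcal{H})\otimes C(\mathbb{G}))$ with $(\mathrm{id}\otimes\Delta)\widetilde U=\widetilde U_{(12)}\widetilde U_{(13)}$. Let $\tau$ be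 a faithful state on $C(\mathbb{G})$ with GNS space $L^2(\mathbb{G})$ and GNS representation $[\cdot]$; then $\mathcal{M}(\mathcal{K}(\mathcal{H})\otimes C(\mathbb{G}))\subset\mathcal{B}(\mathcal{H}\otimes L^2(\mathbb{G}))$. $\widetilde U$ implements $\alpha$ if $(\pi\otimes[\cdot])\alpha(a)=\widetilde U(\pi(a)\otimes[1])\widetilde U^*$ for all $a$ in the algebra. The relation $\widetilde U\circ(D\otimes1)=(D\otimes1)\circ\widetilde U$ on appropriate domains means that $\widetilde U$ maps the domain of the self-adjoint operator $D\otimes1$ on $\mathcal{H}\otimes L^2(\mathbb{G})$ onto itself and the two sides agree there. An action is isometric if some unitary co-representation satisfies both the implementation and the commutation condition. *)

theory Defs
  imports "HOL-Probability.Probability" "HOL-Library.Poly_Mapping"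
begin

section \<open>Complex vector spaces, *-algebras and C*-algebras\<close>

class complex_vector = real_vector +
  fixes scaleC :: "complex \<Rightarrow> 'a \<Rightarrow> 'a"  (infixr \<open>*\<^sub>C\<close> 75)
  assumes scaleC_add_right: "c *\<^sub>C (x + y) = c *\<^sub>C x + c *\<^sub>C y"
    and scaleC_add_left: "(c + d) *\<^sub>C x = c *\<^sub>C x + d *\<^sub>C x"
    and scaleC_scaleC: "c *\<^sub>C d *\<^sub>C x = (c * d) *\<^sub>C x"
    and scaleC_one: "1 *\<^sub>C x = x"
    and scaleR_scaleC: "r *\<^sub>R x = complex_of_real r *\<^sub>C x"

global_interpretation complex_vector: vector_space "scaleC :: complex \<Rightarrow> 'a \<Rightarrow> 'a::complex_vector"
  defines cspan = complex_vector.span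
    and cdependent = complex_vector.dependent
  by unfold_locales (simp_all add: scaleC_add_right scaleC_add_left scaleC_scaleC scaleC_one)

abbreviation clinear :: "('a::complex_vector \<Rightarrow> 'b::complex_vector) \<Rightarrow> bool"
  where "clinear \<equiv> Vector_Spaces.linear scaleC scaleC"

text \<open>Unital, but possibly zero.\<close>

class star_algebra = complex_vector + ring + monoid_mult +
  fixes star :: "'a \<Rightarrow> 'a"
  assumes scaleC_mult_left: "(c *\<^sub>C x) * y = c *\<^sub>C (x * y)"
    and scaleC_mult_right: "x * (c *\<^sub>C y) = c *\<^sub>C (x * y)"
    and star_star: "star (star x) = x"
    and star_add: "star (x + y) = star x + star y"
    and star_scaleC: "star (c *\<^sub>C x) = cnj c *\<^sub>C star x"
    and star_mult: "star (x * y) = star y * star x"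

class cstar_algebra = star_algebra + real_normed_algebra + banach +
  assumes norm_scaleC: "norm (c *\<^sub>C x) = cmod c * norm x"
    and norm_star_mult: "norm (star x * x) = (norm x)\<^sup>2"

definition star_hom_on :: "'a::star_algebra set \<Rightarrow> ('a \<Rightarrow> 'b::star_algebra) \<Rightarrow> bool" where
  "star_hom_on A f \<longleftrightarrow>
     f 1 = 1 \<and>
     (\<forall>x\<in>A. \<forall>y\<in>A. f (x + y) = f x + f y) \<and>
     (\<forall>c. \<forall>x\<in>A. f (c *\<^sub>C x) = c *\<^sub>C f x) \<and>
     (\<forall>x\<in>A. \<forall>y\<in>A. f (x * y) = f x * f y) \<and>
     (\<forall>x\<in>A. f (star x) = star (f x))"

abbreviation star_hom :: "('a::star_algebra \<Rightarrow> 'b::star_algebra) \<Rightarrow> bool"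
  where "star_hom \<equiv> star_hom_on UNIV"

definition cstar_seminorm_on :: "'a::star_algebra set \<Rightarrow> ('a \<Rightarrow> real) \<Rightarrow> bool" where
  "cstar_seminorm_on A \<rho> \<longleftrightarrow>
     (\<forall>x\<in>A. 0 \<le> \<rho> x) \<and>
     (\<forall>x\<in>A. \<forall>y\<in>A. \<rho> (x + y) \<le> \<rho> x + \<rho> y) \<and>
     (\<forall>c. \<forall>x\<in>A. \<rho> (c *\<^sub>C x) = cmod c * \<rho> x) \<and>
     (\<forall>x\<in>A. \<forall>y\<in>A. \<rho> (x * y) \<le> \<rho> x * \<rho> y) \<and>
     (\<forall>x\<in>A. \<rho> (star x * x) = (\<rho> x)\<^sup>2)"

definition cstar_norm_on :: "'a::star_algebra set \<Rightarrow> ('a \<Rightarrow> real) \<Rightarrow> bool" where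
  "cstar_norm_on A \<rho> \<longleftrightarrow> cstar_seminorm_on A \<rho> \<and> (\<forall>x\<in>A. \<rho> x = 0 \<longrightarrow> x = 0)"

instantiation complex :: cstar_algebra
begin

definition scaleC_complex :: "complex \<Rightarrow> complex \<Rightarrow> complex" where "scaleC_complex = (*)"
definition star_complex :: "complex \<Rightarrow> complex" where "star_complex = cnj"

instance
  by standard
    (simp_all add: scaleC_complex_def star_complex_def algebra_simps scaleR_conv_of_real norm_mult
      power2_eq_square)

end

instantiation prod :: (complex_vector, complex_vector) complex_vector
begin

definition scaleC_prod :: "complex \<Rightarrow> 'a \<times> 'b \<Rightarrow> 'a \<times> 'b"
  where "scaleC_prod c p = (c *\<^sub>C fst p, c *\<^sub>C snd p)"

instance
  by standard
    (simp_all add: scaleC_prod_def prod_eq_iff scaleC_add_right scaleC_add_left scaleC_scaleC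
      scaleC_one scaleR_scaleC)

end


section \<open>Universal C*-algebras\<close>

text \<open>
  Words in the letters \<open>g\<close> (coded \<open>(g, False)\<close>) and \<open>g*\<close> (coded \<open>(g, True)\<close>). The product of
  words is written additively, so that \<open>'g star_word \<Rightarrow>\<^sub>0 complex\<close> carries the multiplication of the
  monoid algebra.
\<close>

datatype 'g star_word = Star_Word "('g \<times> bool) list"

instantiation star_word :: (type) monoid_add
begin

definition zero_star_word :: "'a star_word" where "0 = Star_Word []"

fun plus_star_word :: "'a star_word \<Rightarrow> 'a star_word \<Rightarrow> 'a star_word"
  where "Star_Word u + Star_Word v = Star_Word (u @ v)"

instance
proof
  fix a b c :: "'a star_word"
  show "a + b + c = a + (b + c)" by (cases a; cases b; cases c) simp
  show "0 + a = a" "a + 0 = a" by (cases a; simp add: zero_star_word_def)+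
qed

end

fun star_word_adj :: "'g star_word \<Rightarrow> 'g star_word"
  where "star_word_adj (Star_Word u) = Star_Word (rev (map (\<lambda>(g, b). (g, \<not> b)) u))"

lemma star_word_adj_adj [simp]: "star_word_adj (star_word_adj w) = w"
  by (cases w) (simp add: rev_map o_def case_prod_beta)

lemma star_word_adj_plus: "star_word_adj (u + v) = star_word_adj v + star_word_adj u"
  by (cases u; cases v) simp

lift_definition star_poly :: "('g star_word \<Rightarrow>\<^sub>0 complex) \<Rightarrow> ('g star_word \<Rightarrow>\<^sub>0 complex)"
  is "\<lambda>f w. cnj (f (star_word_adj w))"
proof -
  fix f :: "'g star_word \<Rightarrow> complex"
  assume "finite {w. f w \<noteq> 0}"
  then have "finite (star_word_adj ` {w. f w \<noteq> 0})" by simp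
  moreover have "{w. cnj (f (star_word_adj w)) \<noteq> 0} \<subseteq> star_word_adj ` {w. f w \<noteq> 0}"
    by (force intro: image_eqI[where x = "star_word_adj _"])
  ultimately show "finite {w. cnj (f (star_word_adj w)) \<noteq> 0}"
    by (rule rev_finite_subset)
qed

lemma star_poly_add: "star_poly (p + q) = star_poly p + star_poly q"
  by transfer (simp add: fun_eq_iff)

lemma star_poly_star_poly: "star_poly (star_poly p) = p"
  by transfer simp

lemma star_poly_single:
  "star_poly (Poly_Mapping.single w c) = Poly_Mapping.single (star_word_adj w) (cnj c)"
  by transfer (auto simp: fun_eq_iff when_def)

lemma poly_mapping_monomial_induct [case_names zero add]:
  fixes p :: "'w \<Rightarrow>\<^sub>0 'r::monoid_add"
  assumes "P 0" and "\<And>p w c. P p \<Longrightarrow> P (Poly_Mapping.single w c + p)"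
  shows "P p"
proof (induction p rule: update_induct)
  case const
  show ?case by (rule assms(1))
next
  case (update f a b)
  have "Poly_Mapping.update a b f = Poly_Mapping.single a b + f"
    using update(1)
    by (intro poly_mapping_eqI) (auto simp: lookup_add lookup_update lookup_single in_keys_iff when_def)
  then show ?case using assms(2)[OF update(3)] by simp
qed

lemma star_poly_zero [simp]: "star_poly 0 = 0"
  by transfer simp

lemma star_poly_mult: "star_poly (p * q) = star_poly q * star_poly p"
proof (induction p rule: poly_mapping_monomial_induct)
  case zero
  show ?case by simp
next
  case (add p w c)
  have "star_poly (Poly_Mapping.single w c * q) = star_poly q * star_poly (Poly_Mapping.single w c)"
    by (induction q rule: poly_mapping_monomial_induct)
      (simp_all add: mult_single star_poly_single star_word_adj_plus star_poly_add algebra_simps)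
  with add show ?case by (simp add: star_poly_add algebra_simps)
qed

typedef 'g free_star_algebra = "UNIV :: ('g star_word \<Rightarrow>\<^sub>0 complex) set" ..

setup_lifting type_definition_free_star_algebra

instantiation free_star_algebra :: (type) star_algebra
begin

lift_definition zero_free_star_algebra :: "'a free_star_algebra" is 0 .
lift_definition one_free_star_algebra :: "'a free_star_algebra" is 1 .
lift_definition plus_free_star_algebra ::
  "'a free_star_algebra \<Rightarrow> 'a free_star_algebra \<Rightarrow> 'a free_star_algebra" is "(+)" .
lift_definition minus_free_star_algebra ::
  "'a free_star_algebra \<Rightarrow> 'a free_star_algebra \<Rightarrow> 'a free_star_algebra" is "(-)" .
lift_definition uminus_free_star_algebra :: "'a free_star_algebra \<Rightarrow> 'a free_star_algebra"
  is uminus .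
lift_definition times_free_star_algebra ::
  "'a free_star_algebra \<Rightarrow> 'a free_star_algebra \<Rightarrow> 'a free_star_algebra" is "(*)" .
lift_definition scaleC_free_star_algebra ::
  "complex \<Rightarrow> 'a free_star_algebra \<Rightarrow> 'a free_star_algebra"
  is "\<lambda>c p. Poly_Mapping.single 0 c * p" .
lift_definition scaleR_free_star_algebra ::
  "real \<Rightarrow> 'a free_star_algebra \<Rightarrow> 'a free_star_algebra"
  is "\<lambda>r p. Poly_Mapping.single 0 (complex_of_real r) * p" .
lift_definition star_free_star_algebra :: "'a free_star_algebra \<Rightarrow> 'a free_star_algebra"
  is star_poly .

instance
proof
  have comm: "p * Poly_Mapping.single 0 c = Poly_Mapping.single 0 c * p"
    for c and p :: "'a star_word \<Rightarrow>\<^sub>0 complex"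
    by (induction p rule: poly_mapping_monomial_induct) (simp_all add: mult_single algebra_simps)
  have adj0: "star_word_adj 0 = (0 :: 'a star_word)"
    by (simp add: zero_star_word_def)
  fix x y z :: "'a free_star_algebra" and c d :: complex and r s :: real
  show "x + y + z = x + (y + z)" "x + y = y + x" "0 + x = x" "- x + x = 0" "x - y = x + - y"
    "x * y * z = x * (y * z)" "(x + y) * z = x * z + y * z" "x * (y + z) = x * y + x * z"
    "1 * x = x" "x * 1 = x"
    by (transfer; simp add: algebra_simps)+
  show "c *\<^sub>C (x + y) = c *\<^sub>C x + c *\<^sub>C y" "r *\<^sub>R (x + y) = r *\<^sub>R x + r *\<^sub>R y"
    by (transfer; simp add: algebra_simps)+
  show "(c + d) *\<^sub>C x = c *\<^sub>C x + d *\<^sub>C x" "(r + s) *\<^sub>R x = r *\<^sub>R x + s *\<^sub>R x"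
    by (transfer; simp add: single_add algebra_simps)+
  show "c *\<^sub>C d *\<^sub>C x = (c * d) *\<^sub>C x" "r *\<^sub>R s *\<^sub>R x = (r * s) *\<^sub>R x"
    by (transfer; simp add: mult_single flip: mult.assoc)+
  show "1 *\<^sub>C x = x" "1 *\<^sub>R x = x" "r *\<^sub>R x = complex_of_real r *\<^sub>C x"
    by (transfer; simp)+
  show "(c *\<^sub>C x) * y = c *\<^sub>C (x * y)" by transfer (simp add: mult.assoc)
  show "x * (c *\<^sub>C y) = c *\<^sub>C (x * y)" by transfer (simp add: comm flip: mult.assoc)
  show "star (star x) = x" by transfer (rule star_poly_star_poly)
  show "star (x + y) = star x + star y" by transfer (rule star_poly_add)
  show "star (c *\<^sub>C x) = cnj c *\<^sub>C star x"
    by transfer (simp add: star_poly_mult star_poly_single adj0 comm)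
  show "star (x * y) = star y * star x" by transfer (rule star_poly_mult)
qed

end

lift_definition gen :: "'g \<Rightarrow> 'g free_star_algebra"
  is "\<lambda>g. Poly_Mapping.single (Star_Word [(g, False)]) 1" .

text \<open>
  The universal unital C*-algebra on generators \<open>'g\<close> subject to the relations \<open>r = 0\<close> \<open>(r \<in> R)\<close> is
  the Hausdorff completion of the free unital *-algebra in its largest C*-seminorm vanishing on \<open>R\<close>.
  A family in a C*-algebra satisfying the relations is the same thing as such a seminorm together
  with an isometric embedding of its completion, so the last clause says exactly that every such
  family is the image of \<open>g\<close> under a *-homomorphism, without quantifying over types.
\<close>

definition universal_cstar_algebra ::
  "'g free_star_algebra set \<Rightarrow> ('g \<Rightarrow> 'a::cstar_algebra) \<Rightarrow> bool" where
  "universal_cstar_algebra R g \<longleftrightarrow>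
     (\<exists>ev. star_hom ev \<and> (\<forall>i. ev (gen i) = g i) \<and>
       (\<forall>r\<in>R. ev r = 0) \<and>
       closure (range ev) = UNIV \<and>
       (\<forall>\<rho>. cstar_seminorm_on UNIV \<rho> \<and> (\<forall>r\<in>R. \<rho> r = 0) \<longrightarrow> (\<forall>p. \<rho> p \<le> norm (ev p))))"

definition cuntz_relations :: "'e::finite free_star_algebra set" where
  "cuntz_relations =
     {star (gen i) * gen i - 1 | i. True} \<union> {(\<Sum>j\<in>UNIV. gen j * star (gen j)) - 1}"

text \<open>Unitarity of \<open>q\<close> (first two families) and of the entrywise adjoint of \<open>q\<close> (last two).\<close>

definition free_unitary_relations :: "('e::finite \<times> 'e) free_star_algebra set" where
  "free_unitary_relations =
     {(\<Sum>k\<in>UNIV. gen (i, k) * star (gen (j, k))) - of_bool (i = j) *\<^sub>C 1 | i j. True} \<union>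
     {(\<Sum>k\<in>UNIV. star (gen (k, i)) * gen (k, j)) - of_bool (i = j) *\<^sub>C 1 | i j. True} \<union>
     {(\<Sum>k\<in>UNIV. star (gen (i, k)) * gen (j, k)) - of_bool (i = j) *\<^sub>C 1 | i j. True} \<union>
     {(\<Sum>k\<in>UNIV. gen (k, i) * star (gen (k, j))) - of_bool (i = j) *\<^sub>C 1 | i j. True}"


section \<open>Minimal tensor products\<close>

text \<open>
  \<open>t\<close> exhibits \<open>'t\<close> as the completion of the algebraic tensor product of \<open>'a\<close> and \<open>'b\<close> in its
  smallest C*-norm; the fourth clause is injectivity of the algebraic tensor product into \<open>'t\<close>.
\<close>

definition minimal_tensor_product ::
  "('a::cstar_algebra \<Rightarrow> 'b::cstar_algebra \<Rightarrow> 't::cstar_algebra) \<Rightarrow> bool" where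
  "minimal_tensor_product t \<longleftrightarrow>
     (\<forall>b. clinear (\<lambda>a. t a b)) \<and> (\<forall>a. clinear (t a)) \<and>
     (t 1 1 = 1 \<and> (\<forall>a b a' b'. t a b * t a' b' = t (a * a') (b * b')) \<and>
       (\<forall>a b. star (t a b) = t (star a) (star b))) \<and>
     (\<forall>B f. finite B \<and> \<not> cdependent B \<and> (\<Sum>b\<in>B. t (f b) b) = 0 \<longrightarrow> (\<forall>b\<in>B. f b = 0)) \<and>
     closure (cspan {t a b | a b. True}) = UNIV \<and>
     (\<forall>\<rho>. cstar_norm_on (cspan {t a b | a b. True}) \<rho> \<longrightarrow>
       (\<forall>x\<in>cspan {t a b | a b. True}. norm x \<le> \<rho> x))"


section \<open>Hilbert spaces and bounded operators\<close>

class hilbert_space = complex_vector + banach +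
  fixes cinner :: "'a \<Rightarrow> 'a \<Rightarrow> complex"
  assumes cinner_commute: "cinner x y = cnj (cinner y x)"
    and cinner_add_right: "cinner x (y + z) = cinner x y + cinner x z"
    and cinner_scaleC_right: "cinner x (c *\<^sub>C y) = c * cinner x y"
    and cinner_self: "cinner x x = complex_of_real ((norm x)\<^sup>2)"
begin

lemma cinner_add_left: "cinner (x + y) z = cinner x z + cinner y z"
  by (metis cinner_commute cinner_add_right complex_cnj_add)

lemma cinner_scaleC_left: "cinner (c *\<^sub>C x) y = cnj c * cinner x y"
  by (metis cinner_commute cinner_scaleC_right complex_cnj_mult)

end

lemma cinner_zero [simp]: "cinner x 0 = 0" "cinner 0 x = (0::complex)" for x :: "'h::hilbert_space"
  using cinner_add_right[of x 0 0] cinner_add_left[of 0 0 x] by simp_all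

lemma cinner_minus_right: "cinner x (- y) = - cinner x (y::'h::hilbert_space)"
  by (rule minus_unique[symmetric])
    (metis add.right_inverse add_cancel_left_right cinner_add_right)

lemma cinner_minus_left: "cinner (- x) y = - cinner x (y::'h::hilbert_space)"
  by (rule minus_unique[symmetric])
    (metis add.right_inverse add_cancel_left_right cinner_add_left)

lemma cinner_diff_right: "cinner x (y - z) = cinner x y - cinner x (z::'h::hilbert_space)"
  using cinner_add_right[of x y "- z"] by (simp add: cinner_minus_right)

lemma cinner_diff_left: "cinner (x - y) z = cinner x z - cinner y (z::'h::hilbert_space)"
  using cinner_add_left[of x "- y" z] by (simp add: cinner_minus_left)

lemma cinner_scaleR_right: "cinner x (r *\<^sub>R y) = of_real r * cinner x (y::'h::hilbert_space)"
  by (simp add: scaleR_scaleC cinner_scaleC_right)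

lemma hilbert_norm_scaleC: "norm (c *\<^sub>C x) = cmod c * norm (x::'h::hilbert_space)"
proof -
  have "complex_of_real ((norm (c *\<^sub>C x))\<^sup>2) = cnj c * c * of_real ((norm x)\<^sup>2)"
    unfolding cinner_self[symmetric]
    by (simp add: cinner_scaleC_left cinner_scaleC_right mult.assoc)
  also have "\<dots> = of_real ((cmod c * norm x)\<^sup>2)"
    using complex_norm_square[of c] by (simp add: power_mult_distrib mult.commute)
  finally show ?thesis by (simp only: of_real_eq_iff) (simp add: power2_eq_iff_nonneg)
qed

lemma norm_sq_add_scaleR:
  fixes x y :: "'h::hilbert_space"
  shows "(norm (x + t *\<^sub>R y))\<^sup>2 = (norm x)\<^sup>2 + 2 * t * Re (cinner x y) + t\<^sup>2 * (norm y)\<^sup>2"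
proof -
  have "complex_of_real ((norm (x + t *\<^sub>R y))\<^sup>2) = cinner (x + t *\<^sub>R y) (x + t *\<^sub>R y)"
    by (rule cinner_self[symmetric])
  also have "\<dots> = cinner x x + t * (cinner x y + cnj (cinner x y)) + t\<^sup>2 * cinner y y"
    using cinner_commute[of y x]
    by (simp add: cinner_add_left cinner_add_right scaleR_scaleC cinner_scaleC_left
        cinner_scaleC_right algebra_simps power2_eq_square)
  finally have "Re (complex_of_real ((norm (x + t *\<^sub>R y))\<^sup>2)) =
      Re (cinner x x + t * (cinner x y + cnj (cinner x y)) + t\<^sup>2 * cinner y y)"
    by simp
  then show ?thesis by (simp add: cinner_self flip: of_real_power)
qed

lemma quadratic_nonneg_imp:
  fixes a b :: real
  assumes "\<And>t. 0 \<le> 2 * t * b + t\<^sup>2 * a"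
  shows "b = 0"
proof (rule ccontr)
  assume "b \<noteq> 0"
  define s where "s = 1 / (\<bar>a\<bar> + 1)"
  have s: "s > 0" "s * a < 2"
    by (auto simp: s_def field_simps abs_if)
  have "0 \<le> 2 * (- s * b) * b + (- s * b)\<^sup>2 * a"
    by (rule assms)
  also have "\<dots> = s * b\<^sup>2 * (s * a - 2)"
    by (simp add: power2_eq_square algebra_simps)
  also have "\<dots> < 0"
    using s \<open>b \<noteq> 0\<close> by (intro mult_pos_neg) auto
  finally show False by simp
qed

lemma cinner_Cauchy_Schwarz:
  fixes x y :: "'h::hilbert_space"
  shows "cmod (cinner x y) \<le> norm x * norm y"
proof (cases "x = 0")
  case False
  define c where "c = cinner x y / of_real ((norm x)\<^sup>2)"
  have nx: "(norm x)\<^sup>2 > 0" using False by simp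
  have "0 \<le> Re (cinner (y - c *\<^sub>C x) (y - c *\<^sub>C x))"
    by (simp add: cinner_self flip: of_real_power)
  also have "cinner (y - c *\<^sub>C x) (y - c *\<^sub>C x) =
      cinner y y - c * cinner y x - cnj c * cinner x y + cnj c * c * cinner x x"
    by (simp add: cinner_diff_left cinner_diff_right cinner_scaleC_left cinner_scaleC_right
        algebra_simps)
  also have "\<dots> = of_real ((norm y)\<^sup>2) - of_real ((cmod (cinner x y))\<^sup>2 / (norm x)\<^sup>2)"
    using nx cinner_commute[of y x] False complex_norm_square[of "cinner x y"]
    by (simp add: c_def cinner_self field_simps power2_eq_square)
  finally have "0 \<le> (norm y)\<^sup>2 - (cmod (cinner x y))\<^sup>2 / (norm x)\<^sup>2"
    by (simp flip: of_real_diff of_real_power of_real_divide)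
  then have "(cmod (cinner x y))\<^sup>2 \<le> (norm x * norm y)\<^sup>2"
    using nx by (simp add: field_simps power_mult_distrib)
  then show ?thesis by (rule power2_le_imp_le) simp
qed simp

lemma riesz_representation:
  fixes \<phi> :: "'h::hilbert_space \<Rightarrow> complex"
  assumes add: "\<And>x y. \<phi> (x + y) = \<phi> x + \<phi> y" and scale: "\<And>c x. \<phi> (c *\<^sub>C x) = c * \<phi> x"
    and bound: "\<And>x. cmod (\<phi> x) \<le> K * norm x"
  shows "\<exists>z. \<forall>x. cinner z x = \<phi> x"
proof -
  define J where "J x = (norm x)\<^sup>2 - 2 * Re (\<phi> x)" for x
  have scaleR: "\<phi> (r *\<^sub>R x) = of_real r * \<phi> x" for r x
    by (simp add: scaleR_scaleC scale)
  have J_lower: "- K\<^sup>2 \<le> J x" for x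
  proof -
    have "Re (\<phi> x) \<le> K * norm x"
      using bound[of x] complex_Re_le_cmod[of "\<phi> x"] by linarith
    moreover have "0 \<le> (norm x - K)\<^sup>2" by simp
    ultimately show ?thesis by (simp add: J_def power2_eq_square algebra_simps)
  qed
  define m where "m = (INF x. J x)"
  have bdd: "bdd_below (range J)" using J_lower by (auto intro!: bdd_belowI[of _ "- K\<^sup>2"])
  have m_le: "m \<le> J x" for x unfolding m_def by (rule cINF_lower[OF bdd]) simp
  have "\<exists>x. J x < m + 1 / real (Suc n)" for n
    using cINF_less_iff[OF _ bdd, of "m + 1 / real (Suc n)"] by (auto simp: m_def)
  then obtain X where X: "\<And>n. J (X n) < m + 1 / real (Suc n)" by metis
  have mid: "(norm (x - y))\<^sup>2 \<le> 2 * (J x - m) + 2 * (J y - m)" for x y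
  proof -
    have "(norm (x + y))\<^sup>2 + (norm (x - y))\<^sup>2 = 2 * (norm x)\<^sup>2 + 2 * (norm y)\<^sup>2"
      using norm_sq_add_scaleR[of x 1 y] norm_sq_add_scaleR[of x "-1" y] by simp
    moreover have "J ((1/2) *\<^sub>R (x + y)) = (norm (x + y))\<^sup>2 / 4 - Re (\<phi> x) - Re (\<phi> y)"
      by (simp add: J_def scaleR add power2_eq_square add_divide_distrib)
    moreover note m_le[of "(1/2) *\<^sub>R (x + y)"]
    ultimately show ?thesis by (simp add: J_def)
  qed
  have "Cauchy X"
  proof (rule metric_CauchyI)
    fix e :: real
    assume "e > 0"
    then obtain N where N: "1 / real (Suc N) < e\<^sup>2 / 4"
      using reals_Archimedean[of "e\<^sup>2 / 4"] by (auto simp: inverse_eq_divide)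
    have "dist (X i) (X j) < e" if "i \<ge> N" "j \<ge> N" for i j
    proof -
      define d where "d n = 1 / real (Suc n)" for n
      have "d i \<le> d N" "d j \<le> d N"
        using that by (auto simp: d_def intro!: divide_left_mono)
      moreover have "J (X i) < m + d i" "J (X j) < m + d j" "d N < e\<^sup>2 / 4"
        unfolding d_def by (rule X N)+
      ultimately have "(norm (X i - X j))\<^sup>2 < e\<^sup>2"
        using mid[of "X i" "X j"] by argo
      then show ?thesis
        using \<open>e > 0\<close> by (auto simp: dist_norm intro: power_less_imp_less_base)
    qed
    then show "\<exists>M. \<forall>i\<ge>M. \<forall>j\<ge>M. dist (X i) (X j) < e" by blast
  qed
  then obtain z where z: "X \<longlonglongrightarrow> z" by (auto simp: Cauchy_convergent_iff convergent_def)
  have "linear \<phi>"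
    by (rule linearI) (simp_all add: add scaleR scaleR_conv_of_real)
  then have bl: "bounded_linear \<phi>"
    unfolding linear_conv_bounded_linear[symmetric]
    using bound by (intro bounded_linear.intro bounded_linear_axioms.intro) (auto simp: mult.commute)
  have "(\<lambda>n. J (X n)) \<longlonglongrightarrow> J z"
    unfolding J_def by (intro tendsto_intros z bounded_linear.tendsto[OF bl])
  moreover have "(\<lambda>n. m + 1 / real (Suc n)) \<longlonglongrightarrow> m + 0"
    using LIMSEQ_inverse_real_of_nat by (intro tendsto_intros) (simp add: inverse_eq_divide)
  ultimately have "J z \<le> m"
    using X by (intro LIMSEQ_le[of _ "J z" _ m]) (auto intro: less_imp_le)
  then have min: "J z \<le> J x" for x using m_le[of x] by linarith
  have re: "Re (cinner z x) = Re (\<phi> x)" for x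
  proof -
    have "0 \<le> 2 * t * (Re (cinner z x) - Re (\<phi> x)) + t\<^sup>2 * (norm x)\<^sup>2" for t
      using min[of "z + t *\<^sub>R x"]
      by (simp add: J_def norm_sq_add_scaleR add scaleR algebra_simps)
    from quadratic_nonneg_imp[OF this] show ?thesis by simp
  qed
  have "cinner z x = \<phi> x" for x
    using re[of x] re[of "\<i> *\<^sub>C x"] by (simp add: cinner_scaleC_right scale complex_eq_iff)
  then show ?thesis by blast
qed

typedef (overloaded) 'h bop =
  "{T :: 'h::hilbert_space \<Rightarrow>\<^sub>L 'h. \<forall>c x. blinfun_apply T (c *\<^sub>C x) = c *\<^sub>C blinfun_apply T x}"
  by (rule exI[of _ 0]) simp

setup_lifting type_definition_bop

lift_definition bop_apply :: "'h::hilbert_space bop \<Rightarrow> 'h \<Rightarrow> 'h"  (infixr \<open>\<rhd>\<close> 70)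
  is blinfun_apply .

lemma bop_eqI: "(\<And>x. S \<rhd> x = T \<rhd> x) \<Longrightarrow> S = T"
  by transfer (rule blinfun_eqI)

lemma bop_exists:
  fixes f :: "'h::hilbert_space \<Rightarrow> 'h"
  assumes "\<And>x y. f (x + y) = f x + f y" "\<And>c x. f (c *\<^sub>C x) = c *\<^sub>C f x"
    "\<And>x. norm (f x) \<le> K * norm x"
  shows "\<exists>T. \<forall>x. T \<rhd> x = f x"
proof -
  have "bounded_linear f"
    by (rule bounded_linear_intro[where K = K])
      (simp_all add: assms scaleR_scaleC mult.commute[of _ K])
  then have "blinfun_apply (Blinfun f) = f" by (rule bounded_linear_Blinfun_apply)
  with assms(2) show ?thesis
    by (intro exI[of _ "Abs_bop (Blinfun f)"]) (simp add: bop_apply.rep_eq Abs_bop_inverse)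
qed

lemma bop_apply_add: "T \<rhd> (x + y) = T \<rhd> x + T \<rhd> y"
  by transfer (rule blinfun.add_right)

lemma bop_apply_scaleC: "T \<rhd> (c *\<^sub>C x) = c *\<^sub>C (T \<rhd> x)"
  by transfer simp

instantiation bop :: (hilbert_space) real_normed_vector
begin

lift_definition zero_bop :: "'a bop" is 0 by simp
lift_definition plus_bop :: "'a bop \<Rightarrow> 'a bop \<Rightarrow> 'a bop" is "(+)"
  by (simp add: blinfun.add_left scaleC_add_right)
lift_definition minus_bop :: "'a bop \<Rightarrow> 'a bop \<Rightarrow> 'a bop" is "(-)"
  by (simp add: blinfun.diff_left complex_vector.scale_right_diff_distrib)
lift_definition uminus_bop :: "'a bop \<Rightarrow> 'a bop" is uminus
  by (simp add: blinfun.minus_left)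
lift_definition scaleR_bop :: "real \<Rightarrow> 'a bop \<Rightarrow> 'a bop" is "scaleR"
  by (simp add: blinfun.scaleR_left scaleR_scaleC scaleC_scaleC mult.commute)
lift_definition norm_bop :: "'a bop \<Rightarrow> real" is norm .
definition sgn_bop :: "'a bop \<Rightarrow> 'a bop" where "sgn_bop T = scaleR (inverse (norm T)) T"
definition dist_bop :: "'a bop \<Rightarrow> 'a bop \<Rightarrow> real" where "dist_bop S T = norm (S - T)"
definition uniformity_bop :: "('a bop \<times> 'a bop) filter"
  where "uniformity_bop = (INF e\<in>{0<..}. principal {(S, T). dist S T < e})"
definition open_bop :: "'a bop set \<Rightarrow> bool"
  where "open_bop U \<longleftrightarrow> (\<forall>S\<in>U. \<forall>\<^sub>F (S', T) in uniformity. S' = S \<longrightarrow> T \<in> U)"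

instance
proof
  fix S T U :: "'a bop" and r s :: real
  show "S + T + U = S + (T + U)" "S + T = T + S" "0 + S = S" "- S + S = 0" "S - T = S + - T"
    by (transfer; simp add: algebra_simps)+
  show "r *\<^sub>R (S + T) = r *\<^sub>R S + r *\<^sub>R T" "(r + s) *\<^sub>R S = r *\<^sub>R S + s *\<^sub>R S"
    "r *\<^sub>R s *\<^sub>R S = (r * s) *\<^sub>R S" "1 *\<^sub>R S = S"
    by (transfer; simp add: algebra_simps)+
  show "norm S = 0 \<longleftrightarrow> S = 0" by transfer simp
  show "norm (S + T) \<le> norm S + norm T" by transfer (rule norm_triangle_ineq)
  show "norm (r *\<^sub>R S) = \<bar>r\<bar> * norm S" by transfer simp
qed (simp_all add: sgn_bop_def dist_bop_def uniformity_bop_def open_bop_def)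

end

instance bop :: (hilbert_space) banach
proof
  fix X :: "nat \<Rightarrow> 'a bop"
  assume X: "Cauchy X"
  have dist: "dist (Rep_bop S) (Rep_bop T) = dist S T" for S T :: "'a bop"
    by (simp add: dist_norm norm_bop.rep_eq minus_bop.rep_eq)
  have "Cauchy (\<lambda>n. Rep_bop (X n))" using X by (simp add: Cauchy_def dist)
  then obtain L where L: "(\<lambda>n. Rep_bop (X n)) \<longlonglongrightarrow> L"
    by (auto simp: Cauchy_convergent_iff convergent_def)
  have lim: "(\<lambda>n. blinfun_apply (Rep_bop (X n)) x) \<longlonglongrightarrow> blinfun_apply L x" for x
    by (intro tendsto_intros L)
  have "blinfun_apply L (c *\<^sub>C x) = c *\<^sub>C blinfun_apply L x" for c x
  proof -
    have "bounded_linear (\<lambda>y::'a. c *\<^sub>C y)"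
      by (rule bounded_linear_intro[where K = "cmod c"])
        (simp_all add: hilbert_norm_scaleC scaleC_add_right scaleR_scaleC scaleC_scaleC mult.commute)
    then have "(\<lambda>n. c *\<^sub>C blinfun_apply (Rep_bop (X n)) x) \<longlonglongrightarrow> c *\<^sub>C blinfun_apply L x"
      by (rule bounded_linear.tendsto) (rule lim)
    moreover have "(\<lambda>n. c *\<^sub>C blinfun_apply (Rep_bop (X n)) x) \<longlonglongrightarrow> blinfun_apply L (c *\<^sub>C x)"
    proof -
      have "blinfun_apply (Rep_bop (X n)) (c *\<^sub>C x) = c *\<^sub>C blinfun_apply (Rep_bop (X n)) x" for n
        using Rep_bop[of "X n"] by simp
      with lim[of "c *\<^sub>C x"] show ?thesis by simp
    qed
    ultimately show ?thesis by (rule LIMSEQ_unique[symmetric])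
  qed
  then have "Rep_bop (Abs_bop L) = L" by (simp add: Abs_bop_inverse)
  then have "X \<longlonglongrightarrow> Abs_bop L" using L by (simp add: lim_sequentially flip: dist)
  then show "convergent X" by (auto simp: convergent_def)
qed

lemma norm_bop_apply: "norm (T \<rhd> x) \<le> norm T * norm x"
  by transfer (rule norm_blinfun)

lemma norm_bop_bound: "0 \<le> b \<Longrightarrow> (\<And>x. norm (T \<rhd> x) \<le> b * norm x) \<Longrightarrow> norm T \<le> b"
  by transfer (rule norm_blinfun_bound)

lemma bop_adjoint_exists:
  fixes T :: "'h::hilbert_space bop"
  shows "\<exists>S. \<forall>x y. cinner (S \<rhd> x) y = cinner x (T \<rhd> y)"
proof -
  have "\<exists>z. \<forall>y. cinner z y = cinner x (T \<rhd> y)" for x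
  proof (rule riesz_representation[where K = "norm x * norm T"])
    fix y
    have "cmod (cinner x (T \<rhd> y)) \<le> norm x * norm (T \<rhd> y)" by (rule cinner_Cauchy_Schwarz)
    also have "\<dots> \<le> norm x * (norm T * norm y)"
      by (intro mult_left_mono norm_bop_apply) simp
    finally show "cmod (cinner x (T \<rhd> y)) \<le> norm x * norm T * norm y" by (simp add: mult.assoc)
  qed (simp_all add: bop_apply_add bop_apply_scaleC cinner_add_right cinner_scaleC_right)
  then obtain f where f: "\<And>x y. cinner (f x) y = cinner x (T \<rhd> y)" by metis
  have eqI: "u = v" if "\<And>y. cinner u y = cinner v y" for u v :: 'h
  proof -
    have "cinner (u - v) (u - v) = 0" using that by (simp add: cinner_diff_left)
    then show ?thesis by (simp add: cinner_self)
  qed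
  have "norm (f x) \<le> norm T * norm x" for x
  proof (cases "f x = 0")
    case False
    have "(norm (f x))\<^sup>2 = cmod (cinner (f x) (f x))" by (simp add: cinner_self norm_power)
    also have "\<dots> \<le> norm x * norm (T \<rhd> f x)" unfolding f by (rule cinner_Cauchy_Schwarz)
    also have "\<dots> \<le> norm x * (norm T * norm (f x))"
      by (intro mult_left_mono norm_bop_apply) simp
    finally show ?thesis using False by (simp add: power2_eq_square ac_simps)
  qed simp
  then have "\<exists>S. \<forall>x. S \<rhd> x = f x"
    by (intro bop_exists[where K = "norm T"])
      (auto intro!: eqI simp: f cinner_add_left cinner_scaleC_left)
  then show ?thesis using f by metis
qed

instantiation bop :: (hilbert_space) cstar_algebra
begin

lift_definition one_bop :: "'a bop" is id_blinfun by simp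
lift_definition times_bop :: "'a bop \<Rightarrow> 'a bop \<Rightarrow> 'a bop" is "(o\<^sub>L)" by simp
definition scaleC_bop :: "complex \<Rightarrow> 'a bop \<Rightarrow> 'a bop"
  where "scaleC_bop c T = (THE S. \<forall>x. S \<rhd> x = c *\<^sub>C (T \<rhd> x))"
definition star_bop :: "'a bop \<Rightarrow> 'a bop"
  where "star_bop T = (THE S. \<forall>x y. cinner (S \<rhd> x) y = cinner x (T \<rhd> y))"

lemma scaleC_bop_apply: "(c *\<^sub>C T) \<rhd> x = c *\<^sub>C (T \<rhd> x)"
proof -
  have "\<exists>S. \<forall>x. S \<rhd> x = c *\<^sub>C (T \<rhd> x)"
  proof (rule bop_exists[where K = "cmod c * norm T"])
    show "norm (c *\<^sub>C (T \<rhd> x)) \<le> cmod c * norm T * norm x" for x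
      by (simp add: hilbert_norm_scaleC norm_bop_apply mult_left_mono mult.assoc)
  qed (simp_all add: bop_apply_add bop_apply_scaleC scaleC_add_right scaleC_scaleC mult.commute)
  then have "\<exists>!S. \<forall>x. S \<rhd> x = c *\<^sub>C (T \<rhd> x)"
    by (rule ex_ex1I) (rule bop_eqI, simp)
  from theI'[OF this] show ?thesis unfolding scaleC_bop_def by blast
qed

lemma cinner_ext:
  fixes x y :: "'h::hilbert_space"
  assumes "\<And>z. cinner x z = cinner y z"
  shows "x = y"
proof -
  have "cinner (x - y) (x - y) = 0" using assms by (simp add: cinner_diff_left)
  then show ?thesis by (simp add: cinner_self)
qed

lemma star_bop_adjoint: "cinner (star T \<rhd> x) y = cinner x (T \<rhd> y)"
proof -
  have "\<exists>!S. \<forall>x y. cinner (S \<rhd> x) y = cinner x (T \<rhd> y)"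
    by (rule ex_ex1I[OF bop_adjoint_exists]) (rule bop_eqI, rule cinner_ext, simp)
  from theI'[OF this] show ?thesis unfolding star_bop_def by blast
qed

lemma bop_apply_plus: "(S + T) \<rhd> x = S \<rhd> x + T \<rhd> x"
  by transfer (rule blinfun.add_left)

lemma bop_apply_times: "(S * T) \<rhd> x = S \<rhd> T \<rhd> x"
  by transfer simp

lemma bop_apply_one: "1 \<rhd> x = x"
  by transfer simp

instance
proof
  fix S T U :: "'a bop" and c d :: complex and r :: real
  show "c *\<^sub>C (S + T) = c *\<^sub>C S + c *\<^sub>C T" "(c + d) *\<^sub>C S = c *\<^sub>C S + d *\<^sub>C S"
    "c *\<^sub>C d *\<^sub>C S = (c * d) *\<^sub>C S" "1 *\<^sub>C S = S"
    by (rule bop_eqI; simp add: scaleC_bop_apply bop_apply_plus scaleC_add_right scaleC_add_left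
        scaleC_scaleC scaleC_one)+
  have scaleR_apply: "(r *\<^sub>R S) \<rhd> x = r *\<^sub>R (S \<rhd> x)" for x and r and S :: "'a bop"
    by transfer (simp add: blinfun.scaleR_left)
  show "r *\<^sub>R S = complex_of_real r *\<^sub>C S"
    by (rule bop_eqI) (simp add: scaleR_apply scaleC_bop_apply scaleR_scaleC)
  show "S * T * U = S * (T * U)" "1 * S = S" "S * 1 = S"
    "(S + T) * U = S * U + T * U" "S * (T + U) = S * T + S * U"
    "(c *\<^sub>C S) * T = c *\<^sub>C (S * T)" "S * (c *\<^sub>C T) = c *\<^sub>C (S * T)"
    "(r *\<^sub>R S) * T = r *\<^sub>R (S * T)" "S * (r *\<^sub>R T) = r *\<^sub>R (S * T)"
    by (rule bop_eqI; simp add: bop_apply_times bop_apply_one bop_apply_plus bop_apply_add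
        scaleC_bop_apply bop_apply_scaleC scaleR_apply scaleR_scaleC)+
  have star_right: "cinner x (star S \<rhd> y) = cinner (S \<rhd> x) y" for S :: "'a bop" and x y
    unfolding cinner_commute[of x] star_bop_adjoint by (rule cinner_commute[symmetric])
  have starI: "star S = T" if "\<And>x y. cinner (T \<rhd> x) y = cinner x (S \<rhd> y)" for S T :: "'a bop"
    by (rule bop_eqI, rule cinner_ext) (simp add: star_bop_adjoint that)
  show "star (star S) = S" by (rule starI) (simp add: star_right)
  show "star (S + T) = star S + star T"
    by (rule starI) (simp add: bop_apply_plus star_bop_adjoint cinner_add_left cinner_add_right)
  show "star (c *\<^sub>C S) = cnj c *\<^sub>C star S"
    by (rule starI) (simp add: scaleC_bop_apply star_bop_adjoint cinner_scaleC_left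
        cinner_scaleC_right)
  show "star (S * T) = star T * star S"
    by (rule starI) (simp add: bop_apply_times star_bop_adjoint)
  show norm_mult: "norm (S * T) \<le> norm S * norm T" for S T :: "'a bop"
    by transfer (rule norm_blinfun_compose)
  show "norm (c *\<^sub>C S) = cmod c * norm S"
  proof (rule antisym)
    have le: "norm (c *\<^sub>C S) \<le> cmod c * norm S" for c and S :: "'a bop"
      by (rule norm_bop_bound)
        (simp_all add: scaleC_bop_apply hilbert_norm_scaleC norm_bop_apply mult_left_mono
          mult.assoc)
    show "norm (c *\<^sub>C S) \<le> cmod c * norm S" by (rule le)
    show "cmod c * norm S \<le> norm (c *\<^sub>C S)"
    proof (cases "c = 0")
      case False
      have "inverse c *\<^sub>C c *\<^sub>C S = S"
        by (rule bop_eqI) (simp add: False scaleC_bop_apply scaleC_scaleC scaleC_one)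
      then have "norm S \<le> cmod (inverse c) * norm (c *\<^sub>C S)"
        using le[of "inverse c" "c *\<^sub>C S"] by simp
      then have "cmod c * norm S \<le> cmod c * (cmod (inverse c) * norm (c *\<^sub>C S))"
        by (rule mult_left_mono) simp
      also have "\<dots> = norm (c *\<^sub>C S)" using False by (simp add: norm_inverse)
      finally show ?thesis .
    qed simp
  qed
  have sq: "(norm (S \<rhd> x))\<^sup>2 \<le> norm (star S * S) * (norm x)\<^sup>2" for S :: "'a bop" and x
  proof -
    have "(norm (S \<rhd> x))\<^sup>2 = cmod (cinner (star S \<rhd> S \<rhd> x) x)"
      by (simp add: star_bop_adjoint cinner_self norm_power)
    also have "\<dots> \<le> norm ((star S * S) \<rhd> x) * norm x"
      unfolding bop_apply_times by (rule cinner_Cauchy_Schwarz)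
    also have "\<dots> \<le> norm (star S * S) * norm x * norm x"
      by (intro mult_right_mono norm_bop_apply) simp
    also have "\<dots> = norm (star S * S) * (norm x)\<^sup>2" by (simp add: power2_eq_square)
    finally show ?thesis .
  qed
  have sq_norm: "(norm S)\<^sup>2 \<le> norm (star S * S)" for S :: "'a bop"
  proof -
    have "norm (S \<rhd> x) \<le> sqrt (norm (star S * S)) * norm x" for x
      by (rule power2_le_imp_le) (simp_all add: power_mult_distrib sq)
    then have "norm S \<le> sqrt (norm (star S * S))"
      by (intro norm_bop_bound) simp_all
    then have "(norm S)\<^sup>2 \<le> (sqrt (norm (star S * S)))\<^sup>2"
      by (rule power_mono) simp
    then show ?thesis by simp
  qed
  have star_le: "norm S \<le> norm (star S)" for S :: "'a bop"
  proof (cases "norm S = 0")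
    case False
    have "norm S * norm S \<le> norm (star S) * norm S"
      using order_trans[OF sq_norm[of S] norm_mult[of "star S" S]]
      unfolding power2_eq_square .
    moreover have "norm S > 0" using False norm_ge_zero[of S] by linarith
    ultimately show ?thesis by (rule mult_right_le_imp_le)
  qed simp
  have "norm (star S) = norm S"
    using star_le[of S] star_le[of "star S"] unfolding \<open>star (star S) = S\<close> by linarith
  then have "norm (star S * S) \<le> norm S * norm S"
    using norm_mult[of "star S" S] by simp
  then show "norm (star S * S) = (norm S)\<^sup>2"
    using sq_norm[of S] unfolding power2_eq_square by linarith
qed

end


section \<open>Tensor products of Hilbert spaces and operators on them\<close>

definition hilbert_tensor_product ::
  "('h::hilbert_space \<Rightarrow> 'k::hilbert_space \<Rightarrow> 'hk::hilbert_space) \<Rightarrow> bool" where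
  "hilbert_tensor_product t \<longleftrightarrow>
     (\<forall>y. clinear (\<lambda>x. t x y)) \<and> (\<forall>x. clinear (t x)) \<and>
     (\<forall>x y x' y'. cinner (t x y) (t x' y') = cinner x x' * cinner y y') \<and>
     closure (cspan {t x y | x y. True}) = UNIV"

definition bop_tensor ::
  "('h::hilbert_space \<Rightarrow> 'k::hilbert_space \<Rightarrow> 'hk::hilbert_space) \<Rightarrow> 'h bop \<Rightarrow> 'k bop \<Rightarrow> 'hk bop" where
  "bop_tensor t X Y = (THE W. \<forall>x y. W \<rhd> t x y = t (X \<rhd> x) (Y \<rhd> y))"

text \<open>The *-homomorphism \<open>\<rho> \<otimes> \<sigma>\<close>, which is determined by its values on elementary tensors.\<close>

definition tensor_representation ::
  "('a::cstar_algebra \<Rightarrow> 'b::cstar_algebra \<Rightarrow> 't::cstar_algebra) \<Rightarrow>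
   ('h::hilbert_space \<Rightarrow> 'k::hilbert_space \<Rightarrow> 'hk::hilbert_space) \<Rightarrow>
   ('a \<Rightarrow> 'h bop) \<Rightarrow> ('b \<Rightarrow> 'k bop) \<Rightarrow> ('t \<Rightarrow> 'hk bop) \<Rightarrow> bool" where
  "tensor_representation tA tH \<rho> \<sigma> \<Phi> \<longleftrightarrow>
     star_hom \<Phi> \<and> (\<forall>a b. \<Phi> (tA a b) = bop_tensor tH (\<rho> a) (\<sigma> b))"

definition compact_bops :: "'h::hilbert_space bop set" where
  "compact_bops = {T. compact (closure ((\<rhd>) T ` cball 0 1))}"

text \<open>\<open>\<K>(H) \<otimes> \<sigma>(C)\<close> for a faithful representation \<open>\<sigma>\<close> of \<open>C\<close>, as an algebra of operators.\<close>

definition compact_tensor ::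
  "('h::hilbert_space \<Rightarrow> 'k::hilbert_space \<Rightarrow> 'hk::hilbert_space) \<Rightarrow>
   ('c::cstar_algebra \<Rightarrow> 'k bop) \<Rightarrow> 'hk bop set" where
  "compact_tensor t \<sigma> = closure (cspan {bop_tensor t k (\<sigma> c) | k c. k \<in> compact_bops})"

text \<open>
  The multiplier algebra of a nondegenerate C*-algebra \<open>B\<close> of operators, realized as the idealizer
  of \<open>B\<close> in the bounded operators.
\<close>

definition multipliers :: "'h::hilbert_space bop set \<Rightarrow> 'h bop set" where
  "multipliers B = {T. \<forall>b\<in>B. T * b \<in> B \<and> b * T \<in> B}"

text \<open>
  Leg numbering on \<open>H \<otimes> (K \<otimes> K)\<close>, for \<open>U\<close> on \<open>H \<otimes> K\<close>: elementary tensors are total, so these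
  operators are determined by their matrix coefficients.
\<close>

definition leg12 ::
  "('h::hilbert_space \<Rightarrow> 'k::hilbert_space \<Rightarrow> 'hk::hilbert_space) \<Rightarrow> ('k \<Rightarrow> 'k \<Rightarrow> 'kk::hilbert_space) \<Rightarrow>
   ('h \<Rightarrow> 'kk \<Rightarrow> 'hkk::hilbert_space) \<Rightarrow> 'hk bop \<Rightarrow> 'hkk bop" where
  "leg12 tHK tKK tHKK U = (THE W. \<forall>x y z x' y' z'.
     cinner (tHKK x' (tKK y' z')) (W \<rhd> tHKK x (tKK y z)) =
     cinner (tHK x' y') (U \<rhd> tHK x y) * cinner z' z)"

definition leg13 ::
  "('h::hilbert_space \<Rightarrow> 'k::hilbert_space \<Rightarrow> 'hk::hilbert_space) \<Rightarrow> ('k \<Rightarrow> 'k \<Rightarrow> 'kk::hilbert_space) \<Rightarrow>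
   ('h \<Rightarrow> 'kk \<Rightarrow> 'hkk::hilbert_space) \<Rightarrow> 'hk bop \<Rightarrow> 'hkk bop" where
  "leg13 tHK tKK tHKK U = (THE W. \<forall>x y z x' y' z'.
     cinner (tHKK x' (tKK y' z')) (W \<rhd> tHKK x (tKK y z)) =
     cinner (tHK x' z') (U \<rhd> tHK x z) * cinner y' y)"


section \<open>GNS representations and unitary co-representations\<close>

definition faithful_state :: "('c::cstar_algebra \<Rightarrow> complex) \<Rightarrow> bool" where
  "faithful_state \<tau> \<longleftrightarrow>
     clinear \<tau> \<and> \<tau> 1 = 1 \<and> (\<forall>c. \<tau> (star c * c) \<in> \<real>\<^sub>\<ge>\<^sub>0) \<and> (\<forall>c. \<tau> (star c * c) = 0 \<longrightarrow> c = 0)"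

definition gns_representation ::
  "('c::cstar_algebra \<Rightarrow> complex) \<Rightarrow> ('c \<Rightarrow> 'k::hilbert_space bop) \<Rightarrow> 'k \<Rightarrow> bool" where
  "gns_representation \<tau> \<sigma> \<Omega> \<longleftrightarrow>
     star_hom \<sigma> \<and> (\<forall>c. cinner \<Omega> (\<sigma> c \<rhd> \<Omega>) = \<tau> c) \<and> closure (range (\<lambda>c. \<sigma> c \<rhd> \<Omega>)) = UNIV"

text \<open>
  Here \<open>tCC\<close> is the minimal tensor product \<open>C \<otimes> C\<close>, \<open>\<Delta>\<close> the comultiplication of \<open>C\<close>, and \<open>\<sigma>\<close> its
  GNS representation on \<open>K\<close>. The map \<open>\<Phi>\<close> is the extension of \<open>id \<otimes> \<Delta>\<close> from
  \<open>\<K>(H) \<otimes> C\<close> to multiplier algebras; it is unique because \<open>id \<otimes> \<Delta>\<close> is nondegenerate.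
\<close>

definition unitary_corepresentation ::
  "('c::cstar_algebra \<Rightarrow> 'c \<Rightarrow> 'cc::cstar_algebra) \<Rightarrow> ('c \<Rightarrow> 'cc) \<Rightarrow> ('c \<Rightarrow> 'k::hilbert_space bop) \<Rightarrow>
   ('h::hilbert_space \<Rightarrow> 'k \<Rightarrow> 'hk::hilbert_space) \<Rightarrow> ('k \<Rightarrow> 'k \<Rightarrow> 'kk::hilbert_space) \<Rightarrow>
   ('h \<Rightarrow> 'kk \<Rightarrow> 'hkk::hilbert_space) \<Rightarrow> 'hk bop \<Rightarrow> bool" where
  "unitary_corepresentation tCC \<Delta> \<sigma> tHK tKK tHKK U \<longleftrightarrow>
     U \<in> multipliers (compact_tensor tHK \<sigma>) \<and> star U * U = 1 \<and> U * star U = 1 \<and>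
     (\<exists>\<sigma>\<sigma> \<Phi>. tensor_representation tCC tKK \<sigma> \<sigma> \<sigma>\<sigma> \<and>
       star_hom_on (multipliers (compact_tensor tHK \<sigma>)) \<Phi> \<and>
       \<Phi> ` multipliers (compact_tensor tHK \<sigma>) \<subseteq> multipliers (compact_tensor tHKK \<sigma>\<sigma>) \<and>
       (\<forall>k\<in>compact_bops. \<forall>c. \<Phi> (bop_tensor tHK k (\<sigma> c)) = bop_tensor tHKK k (\<sigma>\<sigma> (\<Delta> c))) \<and>
       \<Phi> U = leg12 tHK tKK tHKK U * leg13 tHK tKK tHKK U)"

definition implements ::
  "('a::cstar_algebra \<Rightarrow> 'c::cstar_algebra \<Rightarrow> 'ac::cstar_algebra) \<Rightarrow> ('a \<Rightarrow> 'ac) \<Rightarrow>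
   ('a \<Rightarrow> 'h::hilbert_space bop) \<Rightarrow> ('c \<Rightarrow> 'k::hilbert_space bop) \<Rightarrow>
   ('h \<Rightarrow> 'k \<Rightarrow> 'hk::hilbert_space) \<Rightarrow> 'hk bop \<Rightarrow> bool" where
  "implements tAC \<alpha> \<pi> \<sigma> tHK U \<longleftrightarrow>
     (\<exists>\<Phi>. tensor_representation tAC tHK \<pi> \<sigma> \<Phi> \<and>
       (\<forall>a. \<Phi> (\<alpha> a) = U * bop_tensor tHK (\<pi> a) (\<sigma> 1) * star U))"

text \<open>
  Unbounded operators are represented by their graphs. The operator \<open>D \<otimes> 1\<close> is the closure of the
  algebraic tensor product of \<open>D\<close> with the identity.
\<close>

definition tensor_one ::
  "('h::hilbert_space \<Rightarrow> 'k::hilbert_space \<Rightarrow> 'hk::hilbert_space) \<Rightarrow> ('h \<times> 'h) set \<Rightarrow> ('hk \<times> 'hk) set" where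
  "tensor_one t D = closure (cspan {(t x y, t x' y) | x x' y. (x, x') \<in> D})"

definition commutes_with_unbounded :: "'h::hilbert_space bop \<Rightarrow> ('h \<times> 'h) set \<Rightarrow> bool" where
  "commutes_with_unbounded U T \<longleftrightarrow>
     (\<rhd>) U ` Domain T = Domain T \<and> (\<forall>(x, y)\<in>T. (U \<rhd> x, U \<rhd> y) \<in> T)"

definition isometric_action ::
  "('a::cstar_algebra \<Rightarrow> 'c::cstar_algebra \<Rightarrow> 'ac::cstar_algebra) \<Rightarrow> ('c \<Rightarrow> 'c \<Rightarrow> 'cc::cstar_algebra) \<Rightarrow>
   ('c \<Rightarrow> 'cc) \<Rightarrow> ('a \<Rightarrow> 'ac) \<Rightarrow> ('a \<Rightarrow> 'h::hilbert_space bop) \<Rightarrow> ('h \<times> 'h) set \<Rightarrow>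
   ('c \<Rightarrow> 'k::hilbert_space bop) \<Rightarrow> ('h \<Rightarrow> 'k \<Rightarrow> 'hk::hilbert_space) \<Rightarrow>
   ('k \<Rightarrow> 'k \<Rightarrow> 'kk::hilbert_space) \<Rightarrow> ('h \<Rightarrow> 'kk \<Rightarrow> 'hkk::hilbert_space) \<Rightarrow> bool" where
  "isometric_action tAC tCC \<Delta> \<alpha> \<pi> D \<sigma> tHK tKK tHKK \<longleftrightarrow>
     (\<exists>U. unitary_corepresentation tCC \<Delta> \<sigma> tHK tKK tHKK U \<and>
       implements tAC \<alpha> \<pi> \<sigma> tHK U \<and>
       commutes_with_unbounded U (tensor_one tHK D))"


section \<open>The spectral triple on the infinite path space\<close>

definition cylinder :: "'e list \<Rightarrow> (nat \<Rightarrow> 'e) set" where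
  "cylinder w = {\<omega>. \<forall>i<length w. \<omega> i = w ! i}"

definition square_integrable :: "'x measure \<Rightarrow> ('x \<Rightarrow> complex) set" where
  "square_integrable M = {f \<in> borel_measurable M. integrable M (\<lambda>\<omega>. (cmod (f \<omega>))\<^sup>2)}"

text \<open>
  \<open>cls\<close> exhibits \<open>'h\<close> as \<open>L\<^sup>2(M)\<close>, sending a square-integrable function to its class. (By the
  formula for inner products, two functions have the same class iff they agree a.e.)
\<close>

definition L2_space :: "'x measure \<Rightarrow> (('x \<Rightarrow> complex) \<Rightarrow> 'h::hilbert_space) \<Rightarrow> bool" where
  "L2_space M cls \<longleftrightarrow>
     (\<forall>f\<in>square_integrable M. \<forall>g\<in>square_integrable M. cls (\<lambda>\<omega>. f \<omega> + g \<omega>) = cls f + cls g) \<and>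
     (\<forall>c. \<forall>f\<in>square_integrable M. cls (\<lambda>\<omega>. c * f \<omega>) = c *\<^sub>C cls f) \<and>
     (\<forall>f\<in>square_integrable M. \<forall>g\<in>square_integrable M.
        cinner (cls f) (cls g) = (LINT \<omega>|M. cnj (f \<omega>) * g \<omega>)) \<and>
     cls ` square_integrable M = UNIV"

definition path_subspace ::
  "(((nat \<Rightarrow> 'e) \<Rightarrow> complex) \<Rightarrow> 'h::hilbert_space) \<Rightarrow> int \<Rightarrow> 'h set" where
  "path_subspace cls k =
     (if k = -1 then cspan {cls (\<lambda>\<omega>. 1)}
      else cspan {cls (indicator (cylinder w)) | w. int (length w) \<le> k})"

definition orth_proj :: "'h::hilbert_space set \<Rightarrow> 'h \<Rightarrow> 'h" where
  "orth_proj V x = (THE y. y \<in> V \<and> (\<forall>v\<in>V. cinner v (x - y) = 0))"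

text \<open>
  The graph of \<open>D = \<Sum>\<^sub>q a\<^sub>q (\<Xi>\<^sub>q - \<Xi>\<^sub>q\<^sub>-\<^sub>1)\<close>; the terms are pairwise orthogonal, so the series
  converges exactly on the domain of the self-adjoint operator \<open>D\<close>.
\<close>

definition dirac :: "(((nat \<Rightarrow> 'e) \<Rightarrow> complex) \<Rightarrow> 'h::hilbert_space) \<Rightarrow> (nat \<Rightarrow> real) \<Rightarrow> ('h \<times> 'h) set" where
  "dirac cls a = {(x, y).
     (\<lambda>q. a q *\<^sub>R (orth_proj (path_subspace cls (int q)) x
                 - orth_proj (path_subspace cls (int q - 1)) x)) sums y}"

end

theory Submission
  imports Defs
begin

text \<open>
  Since \<open>\<Xi>\<^sub>0 = \<Xi>\<^sub>-\<^sub>1\<close>, the kernel of \<open>D\<close> consists of the constants. A unitary \<open>U\<close> commuting with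
  \<open>D \<otimes> 1\<close> therefore maps \<open>1 \<otimes> L\<^sup>2(G)\<close> onto itself. If \<open>U\<close> implements the action, apply
  \<open>U (\<pi>(S\<^sub>i) \<otimes> 1) U* = \<Sum>\<^sub>j \<pi>(S\<^sub>j) \<otimes> q\<^sub>j\<^sub>i\<close> to \<open>1 \<otimes> y\<close> and sum over \<open>i\<close>: because
  \<open>\<Sum>\<^sub>i \<pi>(S\<^sub>i) 1\<close> is again constant, comparing the components along \<open>\<chi>\<^sub>[\<^sub>j\<^sub>]\<close> yields
  \<open>\<Sum>\<^sub>i q\<^sub>j\<^sub>i = 1\<close>, contrary to the character \<open>q\<^sub>i\<^sub>j \<mapsto> - \<delta>\<^sub>i\<^sub>j\<close> of \<open>C(U\<^sub>n\<^sup>+)\<close>.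
\<close>

section \<open>Characters of universal C*-algebras\<close>

fun word_eval :: "('g \<Rightarrow> complex) \<Rightarrow> 'g star_word \<Rightarrow> complex" where
  "word_eval s (Star_Word u) = prod_list (map (\<lambda>(g, b). if b then cnj (s g) else s g) u)"

lemma word_eval_plus: "word_eval s (u + v) = word_eval s u * word_eval s v"
  by (cases u; cases v) simp

lemma word_eval_adj: "word_eval s (star_word_adj u) = cnj (word_eval s u)"
proof (cases u)
  case (Star_Word v)
  show ?thesis unfolding Star_Word
  proof (induction v)
    case (Cons p v)
    then show ?case by (cases p; cases "snd p") simp_all
  qed simp
qed

definition poly_eval :: "('g \<Rightarrow> complex) \<Rightarrow> ('g star_word \<Rightarrow>\<^sub>0 complex) \<Rightarrow> complex" where
  "poly_eval s p = Sum_any (\<lambda>w. Poly_Mapping.lookup p w * word_eval s w)"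

lemma poly_eval_zero: "poly_eval s 0 = 0"
  by (simp add: poly_eval_def)

lemma poly_eval_single: "poly_eval s (Poly_Mapping.single w c) = c * word_eval s w"
  unfolding poly_eval_def by (subst Sum_any.expand_superset[of "{w}"]) (auto simp: lookup_single when_def)

lemma poly_eval_add: "poly_eval s (p + q) = poly_eval s p + poly_eval s q"
proof -
  have "finite {w. Poly_Mapping.lookup r w * word_eval s w \<noteq> 0}" for r :: "'a star_word \<Rightarrow>\<^sub>0 complex"
    by (rule finite_subset[OF _ finite_keys[of r]]) (auto simp: in_keys_iff)
  then show ?thesis
    by (simp add: poly_eval_def lookup_add algebra_simps Sum_any.distrib)
qed

lemma poly_eval_mult: "poly_eval s (p * q) = poly_eval s p * poly_eval s q"
proof (induction p rule: poly_mapping_monomial_induct)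
  case (add p w c)
  have "poly_eval s (Poly_Mapping.single w c * q) = c * word_eval s w * poly_eval s q"
    by (induction q rule: poly_mapping_monomial_induct)
      (simp_all add: poly_eval_zero poly_eval_add poly_eval_single mult_single word_eval_plus algebra_simps)
  with add show ?case by (simp add: poly_eval_add poly_eval_single algebra_simps)
qed (simp add: poly_eval_zero)

lemma poly_eval_star: "poly_eval s (star_poly p) = cnj (poly_eval s p)"
  by (induction p rule: poly_mapping_monomial_induct)
    (simp_all add: poly_eval_zero poly_eval_add poly_eval_single star_poly_add star_poly_single word_eval_adj)

lift_definition free_character :: "('g \<Rightarrow> complex) \<Rightarrow> 'g free_star_algebra \<Rightarrow> complex" is poly_eval .

lemma free_character_gen: "free_character s (gen g) = s g"
  by transfer (simp add: poly_eval_single)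

lemma star_hom_free_character: "star_hom (free_character (s :: 'a \<Rightarrow> complex))"
proof -
  have one: "word_eval s 0 = 1" for s :: "'a \<Rightarrow> complex" by (simp add: zero_star_word_def)
  have "free_character s 1 = 1"
    by transfer (simp add: poly_eval_single one flip: single_one)
  moreover have "free_character s (x + y) = free_character s x + free_character s y"
    "free_character s (x * y) = free_character s x * free_character s y"
    "free_character s (star x) = star (free_character s x)"
    "free_character s (c *\<^sub>C x) = c *\<^sub>C free_character s x" for c x y
    by (transfer; simp add: poly_eval_add poly_eval_mult poly_eval_star poly_eval_single one
        star_complex_def scaleC_complex_def)+
  ultimately show ?thesis by (simp add: star_hom_on_def)
qed

section \<open>Consequences of the universal property: relations and norm bounds by
  characters\<close>

lemma star_hom_zero: "star_hom f \<Longrightarrow> f 0 = 0"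
  unfolding star_hom_on_def by (metis UNIV_I add_cancel_right_left)

lemma star_hom_diff:
  assumes "star_hom f"
  shows "f (x - y) = f x - f y"
proof -
  have "f (x - y) + f y = f x"
    using assms unfolding star_hom_on_def by (metis UNIV_I diff_add_cancel)
  then show ?thesis by (simp add: eq_diff_eq)
qed

lemma star_hom_sum:
  assumes "star_hom f"
  shows "f (\<Sum>i\<in>I. g i) = (\<Sum>i\<in>I. f (g i))"
  using assms
  by (induction I rule: infinite_finite_induct) (auto simp: star_hom_zero, simp add: star_hom_on_def)

lemma star_hom_scaleC: "star_hom f \<Longrightarrow> f (c *\<^sub>C x) = c *\<^sub>C f x"
  and star_hom_mult: "star_hom f \<Longrightarrow> f (x * y) = f x * f y"
  and star_hom_star: "star_hom f \<Longrightarrow> f (star x) = star (f x)"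
  and star_hom_one: "star_hom f \<Longrightarrow> f 1 = 1"
  by (simp_all add: star_hom_on_def)

text \<open>This admits characters to the maximality clause of
  \<open>universal_cstar_algebra\<close>: a character that kills the relations is dominated by the
  norm of the universal algebra.\<close>

lemma cstar_seminorm_cmod_star_hom:
  assumes "star_hom (\<epsilon> :: _ \<Rightarrow> complex)"
  shows "cstar_seminorm_on UNIV (\<lambda>p. cmod (\<epsilon> p))"
  using assms unfolding cstar_seminorm_on_def star_hom_on_def
  by (auto simp: norm_mult norm_triangle_ineq scaleC_complex_def star_complex_def power2_eq_square)

text \<open>The evaluation map kills the relations. Under \<pi> the generators become isometries,
  which is what bounds the operators \<open>bop_tensor tHK (\<pi> (S j)) _\<close>.\<close>

lemma cuntz_isometry:
  assumes "universal_cstar_algebra cuntz_relations S"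
  shows "star (S i) * S i = 1"
proof -
  obtain ev where ev: "star_hom ev" "\<And>i. ev (gen i) = S i" "\<And>r. r \<in> cuntz_relations \<Longrightarrow> ev r = 0"
    using assms by (auto simp: universal_cstar_algebra_def)
  have "star (gen i) * gen i - 1 \<in> cuntz_relations" by (auto simp: cuntz_relations_def)
  from ev(3)[OF this] show ?thesis
    by (simp add: star_hom_diff[OF ev(1)] star_hom_mult[OF ev(1)] star_hom_star[OF ev(1)]
        star_hom_one[OF ev(1)] ev(2))
qed

text \<open>This is the diagonal of the second family of relations. It makes each column of
  \<sigma>(q) an isometry from one copy of the GNS space into a finite direct sum.\<close>

lemma free_unitary_column:
  assumes "universal_cstar_algebra free_unitary_relations q"
  shows "(\<Sum>k\<in>UNIV. star (q (k, i)) * q (k, i)) = 1"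
proof -
  obtain ev where ev: "star_hom ev" "\<And>i. ev (gen i) = q i"
    "\<And>r. r \<in> free_unitary_relations \<Longrightarrow> ev r = 0"
    using assms by (auto simp: universal_cstar_algebra_def)
  have "(\<Sum>k\<in>UNIV. star (gen (k, i)) * gen (k, i)) - of_bool (i = i) *\<^sub>C 1 \<in> free_unitary_relations"
    unfolding free_unitary_relations_def by blast
  from ev(3)[OF this] show ?thesis
    by (simp add: star_hom_diff[OF ev(1)] star_hom_mult[OF ev(1)] star_hom_star[OF ev(1)]
        star_hom_one[OF ev(1)] star_hom_sum[OF ev(1)] ev(2) scaleC_one)
qed

text \<open>Minus the identity matrix is unitary, and so is its entrywise conjugate. It thus gives a
  character \<epsilon> that kills the relations, and the modulus of \<epsilon> is at most the
  universal norm. On a row sum minus 1 it takes the value -2.\<close>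

lemma free_unitary_row_sum_neq_one:
  fixes q :: "'e::finite \<times> 'e \<Rightarrow> 'a::cstar_algebra"
  assumes "universal_cstar_algebra free_unitary_relations q"
  shows "(\<Sum>i\<in>UNIV. q (j, i)) \<noteq> 1"
proof
  assume row: "(\<Sum>i\<in>UNIV. q (j, i)) = 1"
  obtain ev where ev: "star_hom ev" "\<And>i. ev (gen i) = q i"
    "\<And>\<rho> p. cstar_seminorm_on UNIV \<rho> \<Longrightarrow> (\<forall>r\<in>free_unitary_relations. \<rho> r = 0) \<Longrightarrow> \<rho> p \<le> norm (ev p)"
    using assms by (auto simp: universal_cstar_algebra_def)
  \<comment> \<open>The sign matters: the identity matrix (the counit) has row sums 1 and would give
    no contradiction.\<close>
  define \<epsilon> where "\<epsilon> = free_character (\<lambda>(i :: 'e, k). - of_bool (i = k) :: complex)"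
  have hom: "star_hom \<epsilon>" unfolding \<epsilon>_def by (rule star_hom_free_character)
  have gen: "\<epsilon> (gen (i, k)) = - of_bool (i = k)" for i k
    by (simp add: \<epsilon>_def free_character_gen)
  note hom_simps = star_hom_diff[OF hom] star_hom_mult[OF hom] star_hom_star[OF hom]
    star_hom_one[OF hom] star_hom_sum[OF hom] star_hom_scaleC[OF hom] gen
  have "\<epsilon> r = 0" if "r \<in> free_unitary_relations" for r
    using that unfolding free_unitary_relations_def
    by (auto simp: hom_simps star_complex_def scaleC_complex_def of_bool_def if_distrib[of cnj]
        if_distrib[of "\<lambda>x. x * _"] if_distrib[of uminus] if_distrib[of "\<lambda>x. _ * x"] sum.delta sum.delta' cong: if_cong)
  then have "cmod (\<epsilon> ((\<Sum>i\<in>UNIV. gen (j, i)) - 1)) \<le> norm (ev ((\<Sum>i\<in>UNIV. gen (j, i)) - 1))"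
    by (intro ev(3) cstar_seminorm_cmod_star_hom hom) simp
  moreover have "ev ((\<Sum>i\<in>UNIV. gen (j, i)) - 1) = 0"
    by (simp add: star_hom_diff[OF ev(1)] star_hom_one[OF ev(1)] star_hom_sum[OF ev(1)] ev(2) row)
  moreover have "\<epsilon> ((\<Sum>i\<in>UNIV. gen (j, i)) - 1) = -2"
    by (simp add: hom_simps of_bool_def sum_negf)
  ultimately show False by simp
qed

section \<open>Operators on Hilbert spaces and their tensor products\<close>

lemma cinner_eq_0_iff [simp]: "cinner x x = 0 \<longleftrightarrow> x = (0::'h::hilbert_space)"
  by (simp add: cinner_self)

lemma cinner_sum_right: "cinner x (\<Sum>i\<in>I. f i) = (\<Sum>i\<in>I. cinner x (f i :: 'h::hilbert_space))"
  by (induction I rule: infinite_finite_induct) (auto simp: cinner_add_right)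

lemma cinner_sum_left: "cinner (\<Sum>i\<in>I. f i) x = (\<Sum>i\<in>I. cinner (f i :: 'h::hilbert_space) x)"
  by (induction I rule: infinite_finite_induct) (auto simp: cinner_add_left)

lemma cinner_eq_0_commute: "cinner x y = 0 \<longleftrightarrow> cinner y (x::'h::hilbert_space) = 0"
  by (metis cinner_commute complex_cnj_zero)

lemma bounded_linear_cinner: "bounded_linear (cinner (x::'h::hilbert_space))"
  by (rule bounded_linear_intro[where K = "norm x"])
    (simp_all add: cinner_add_right cinner_scaleR_right scaleR_conv_of_real
      cinner_Cauchy_Schwarz mult.commute[of _ "norm x"])

lemma bounded_linear_bop: "bounded_linear ((\<rhd>) T)"
  by (rule bounded_linear_intro[where K = "norm T"])
    (simp_all add: bop_apply_add bop_apply_scaleC scaleR_scaleC norm_bop_apply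
      mult.commute[of _ "norm T"])

lemmas continuous_on_cinner [continuous_intros] = bounded_linear.continuous_on[OF bounded_linear_cinner]
lemmas continuous_on_bop [continuous_intros] = bounded_linear.continuous_on[OF bounded_linear_bop]

lemma bop_apply_sum: "T \<rhd> (\<Sum>i\<in>I. f i) = (\<Sum>i\<in>I. T \<rhd> f i)"
  by (rule linear_sum) (rule bounded_linear.linear[OF bounded_linear_bop])

lemma bop_sum_apply: "(\<Sum>i\<in>I. T i) \<rhd> x = (\<Sum>i\<in>I. T i \<rhd> x)"
proof -
  have "0 \<rhd> x = 0" using bop_apply_plus[of 0 0 x] by simp
  then show ?thesis
    by (induction I rule: infinite_finite_induct) (auto simp: bop_apply_plus)
qed

text \<open>The vectors satisfying \<open>P\<close> form a closed complex subspace containing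
  \<open>A\<close>.\<close>

lemma closure_cspan_induct [consumes 1, case_names generator zero add scale closed]:
  assumes "x \<in> closure (cspan A)"
    and "\<And>x. x \<in> A \<Longrightarrow> P x" and "P 0" and "\<And>x y. P x \<Longrightarrow> P y \<Longrightarrow> P (x + y)"
    and "\<And>c x. P x \<Longrightarrow> P (c *\<^sub>C x)" and "closed {x. P x}"
  shows "P x"
proof -
  have "cspan A \<subseteq> {x. P x}"
    by (rule complex_vector.span_minimal) (auto simp: complex_vector.subspace_def assms)
  then have "closure (cspan A) \<subseteq> {x. P x}" using assms(6) by (rule closure_minimal)
  with assms(1) show ?thesis by auto
qed

section \<open>Orthogonal projections onto finitely spanned subspaces\<close>

lemma cinner_orthogonal_cspan:
  fixes z :: "'h::hilbert_space"
  assumes "\<And>v. v \<in> B \<Longrightarrow> cinner v z = 0" and "v \<in> cspan B"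
  shows "cinner v z = 0"
  using assms(2)
  by (induction rule: complex_vector.span_induct_alt) (auto simp: cinner_add_left cinner_scaleC_left assms(1))

text \<open>Gram-Schmidt: the new vector \<open>b\<close> is replaced by its component
  \<open>b'\<close> orthogonal to the span of \<open>B\<close>, and the component of
  \<open>x\<close> along \<open>b'\<close> is added to the projection already found.\<close>

lemma ex_projection_cspan:
  fixes x :: "'h::hilbert_space"
  assumes "finite B"
  shows "\<exists>y\<in>cspan B. \<forall>v\<in>cspan B. cinner v (x - y) = 0"
  using assms
proof (induction B arbitrary: x)
  case empty
  show ?case by (simp add: complex_vector.span_empty)
next
  case (insert b B)
  obtain b0 where b0: "b0 \<in> cspan B" "\<forall>v\<in>cspan B. cinner v (b - b0) = 0" using insert.IH by blast
  obtain y where y: "y \<in> cspan B" "\<forall>v\<in>cspan B. cinner v (x - y) = 0" using insert.IH by blast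
  define b' where "b' = b - b0"
  \<comment> \<open>If \<open>b\<close> lies in the span of \<open>B\<close>, then
    \<open>b' = 0\<close>; division by zero yields 0, and \<open>z = y\<close> is still
    correct.\<close>
  define z where "z = y + (cinner b' (x - y) / cinner b' b') *\<^sub>C b'"
  have sub: "cspan B \<subseteq> cspan (insert b B)" by (rule complex_vector.span_mono) auto
  have b': "b' \<in> cspan (insert b B)" unfolding b'_def
    using b0(1) sub complex_vector.span_base[of b "insert b B"]
    by (intro complex_vector.span_diff) auto
  have z: "z \<in> cspan (insert b B)" unfolding z_def
    using y(1) sub b' by (intro complex_vector.span_add complex_vector.span_scale) auto
  have orth: "cinner v (x - z) = 0" if "v \<in> cspan B" for v
  proof -
    have "x - z = (x - y) - (cinner b' (x - y) / cinner b' b') *\<^sub>C b'" by (simp add: z_def)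
    moreover have "cinner v (x - y) = 0" "cinner v b' = 0" using that b0(2) y(2) by (simp_all add: b'_def)
    ultimately show ?thesis by (simp only: cinner_diff_right[of v "x - y"] cinner_scaleC_right) simp
  qed
  have "cinner b' (x - z) = 0"
    by (cases "b' = 0") (simp_all add: z_def cinner_diff_right cinner_add_right cinner_scaleC_right)
  moreover have "cinner b0 (x - z) = 0" using b0(1) orth by blast
  moreover have "b = b' + b0" by (simp add: b'_def)
  ultimately have "cinner b (x - z) = 0" by (simp add: cinner_add_left)
  then have "cinner v (x - z) = 0" if "v \<in> insert b B" for v
    using that orth complex_vector.span_base[of v B] by auto
  then show ?case using z cinner_orthogonal_cspan by blast
qed

text \<open>\<open>orth_proj\<close> is a definite description, so uniqueness is the point: for two
  candidates, \<open>y' - y\<close> lies in the span and equals \<open>(x - y) - (x - y')\<close>,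
  hence is orthogonal to itself.\<close>

lemma orth_proj_eqI:
  fixes x :: "'h::hilbert_space"
  assumes "y \<in> cspan B" "\<And>v. v \<in> cspan B \<Longrightarrow> cinner v (x - y) = 0"
  shows "orth_proj (cspan B) x = y"
  unfolding orth_proj_def
proof (rule the_equality)
  show "y \<in> cspan B \<and> (\<forall>v\<in>cspan B. cinner v (x - y) = 0)" using assms by blast
  fix y' assume y': "y' \<in> cspan B \<and> (\<forall>v\<in>cspan B. cinner v (x - y') = 0)"
  then have "y' - y \<in> cspan B" using assms(1) by (simp add: complex_vector.span_diff)
  then have "cinner (y' - y) ((x - y) - (x - y')) = 0"
    using assms(2) y' by (simp only: cinner_diff_right[of _ "x - y"]) simp
  then show "y' = y" by simp
qed

lemma orth_proj_cspan:
  fixes x :: "'h::hilbert_space"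
  assumes "finite B"
  shows orth_proj_in_cspan: "orth_proj (cspan B) x \<in> cspan B"
    and cinner_orth_proj: "v \<in> cspan B \<Longrightarrow> cinner v (orth_proj (cspan B) x) = cinner v x"
proof -
  obtain y where y: "y \<in> cspan B" "\<And>v. v \<in> cspan B \<Longrightarrow> cinner v (x - y) = 0"
    using ex_projection_cspan[OF assms, of x] by blast
  then have eq: "orth_proj (cspan B) x = y" by (rule orth_proj_eqI)
  show "orth_proj (cspan B) x \<in> cspan B" using y eq by simp
  show "cinner v (orth_proj (cspan B) x) = cinner v x" if "v \<in> cspan B"
    using y(2)[OF that] by (simp add: eq cinner_diff_right)
qed

text \<open>The closure of the graph is the graph of the extension.\<close>

lemma ex_bop_extension:
  fixes g f :: "'i \<Rightarrow> 'h::hilbert_space"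
  assumes total: "closure (cspan (range g)) = UNIV"
    and bound: "\<And>I c. finite I \<Longrightarrow> norm (\<Sum>i\<in>I. c i *\<^sub>C f i) \<le> norm (\<Sum>i\<in>I. c i *\<^sub>C g i)"
  shows "\<exists>W. \<forall>i. W \<rhd> g i = f i"
proof -
  define h where "h i = (g i, f i)" for i
  define G where "G = cspan (range h)"
  have add: "p + p' \<in> G" if "p \<in> G" "p' \<in> G" for p p'
    using that unfolding G_def by (rule complex_vector.span_add)
  have scale: "c *\<^sub>C p \<in> G" if "p \<in> G" for c p
    using that unfolding G_def by (rule complex_vector.span_scale)
  have diff: "p - p' \<in> G" if "p \<in> G" "p' \<in> G" for p p'
    using that unfolding G_def by (rule complex_vector.span_diff)
  \<comment> \<open>The bound makes the linear graph \<open>G\<close> contractive. Applied to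
    differences of pairs, this shows that \<open>G\<close> and its closure are
    single-valued.\<close>
  have contr: "norm (snd p) \<le> norm (fst p)" if "p \<in> G" for p
  proof -
    have "\<exists>A r. p = (\<Sum>a\<in>A. r a *\<^sub>C a) \<and> finite A \<and> A \<subseteq> range h"
      using that unfolding G_def complex_vector.span_explicit by (rule CollectD)
    then obtain A r where A: "p = (\<Sum>a\<in>A. r a *\<^sub>C a)" "finite A" "A \<subseteq> range h"
      by (elim exE conjE) (rule that)
    \<comment> \<open>A span element is a sum over a set of vectors. An injective choice of indices
      turns it into a sum over indices, even where \<open>h\<close> repeats values.\<close>
    from iffD1[OF subset_image_inj A(3)] obtain I where I: "I \<subseteq> UNIV" "inj_on h I" "A = h ` I"
      by (elim exE conjE) (rule that)
    have "finite I" using A(2) I by (simp add: finite_image_iff)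
    have "p = (\<Sum>i\<in>I. r (h i) *\<^sub>C h i)"
      unfolding A(1) I(3) by (subst sum.reindex[OF I(2)]) simp
    then have "p = (\<Sum>i\<in>I. r (h i) *\<^sub>C g i, \<Sum>i\<in>I. r (h i) *\<^sub>C f i)"
      by (simp add: scaleC_prod_def sum_prod h_def)
    then show ?thesis using bound[OF \<open>finite I\<close>, of "\<lambda>i. r (h i)"] by simp
  qed
  have lift: "\<exists>y. (x, y) \<in> G" if "x \<in> cspan (range g)" for x
    using that
  proof (induction rule: complex_vector.span_induct_alt)
    case base
    have "0 \<in> G" unfolding G_def by (rule complex_vector.span_zero)
    then show ?case unfolding zero_prod_def by (rule exI)
  next
    case (step c x y)
    then obtain i y' where "x = g i" "(y, y') \<in> G" by blast
    moreover have "h i \<in> G" unfolding G_def by (rule complex_vector.span_base) simp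
    ultimately show ?case
      using add[OF scale[of "h i" c], of "(y, y')"] by (auto simp: scaleC_prod_def h_def)
  qed
  have ex: "\<exists>y. \<exists>X Y. X \<longlonglongrightarrow> x \<and> Y \<longlonglongrightarrow> y \<and> (\<forall>n. (X n, Y n) \<in> G)" for x
  proof -
    have "x \<in> closure (cspan (range g))" using total by simp
    then obtain X where X: "\<And>n. X n \<in> cspan (range g)" "X \<longlonglongrightarrow> x"
      unfolding closure_sequential by blast
    have "\<forall>n. \<exists>y. (X n, y) \<in> G" using lift[OF X(1)] by (rule allI)
    from choice[OF this] obtain Y where Y: "\<And>n. (X n, Y n) \<in> G" by (elim exE) (rule that, erule spec)
    have "dist (Y m) (Y n) \<le> dist (X m) (X n)" for m n
      using contr[OF diff[OF Y[of m] Y[of n]]] by (simp add: dist_norm)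
    moreover have "Cauchy X" using X(2) by (rule LIMSEQ_imp_Cauchy)
    ultimately have "Cauchy Y" unfolding Cauchy_def by (meson order_le_less_trans)
    then obtain y where "Y \<longlonglongrightarrow> y" by (auto simp: Cauchy_convergent_iff convergent_def)
    with X(2) Y show ?thesis by (intro exI conjI allI)
  qed
  \<comment> \<open>Some limit is chosen; \<open>uniq\<close> shows that it is independent of the
    approximating sequence.\<close>
  define F where "F x = (SOME y. \<exists>X Y. X \<longlonglongrightarrow> x \<and> Y \<longlonglongrightarrow> y \<and> (\<forall>n. (X n, Y n) \<in> G))" for x
  have F: "\<exists>X Y. X \<longlonglongrightarrow> x \<and> Y \<longlonglongrightarrow> F x \<and> (\<forall>n. (X n, Y n) \<in> G)" for x
    unfolding F_def by (rule someI_ex) (rule ex)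
  have lim: "norm y \<le> norm x" if "X \<longlonglongrightarrow> x" "Y \<longlonglongrightarrow> y" "\<And>n. (X n, Y n) \<in> G" for X Y x y
    using contr[OF that(3)] by (intro LIMSEQ_le[OF tendsto_norm[OF that(2)] tendsto_norm[OF that(1)]]) auto
  have uniq: "F x = y" if "X \<longlonglongrightarrow> x" "Y \<longlonglongrightarrow> y" "\<And>n. (X n, Y n) \<in> G" for X Y x y
  proof -
    obtain X' Y' where X': "X' \<longlonglongrightarrow> x" "Y' \<longlonglongrightarrow> F x" "\<And>n. (X' n, Y' n) \<in> G"
      using F[of x] by (elim exE conjE) (rule that, assumption, assumption, erule spec)
    have "norm (F x - y) \<le> norm (x - x)"
      using diff[OF X'(3) that(3)]
      by (intro lim[OF tendsto_diff[OF X'(1) that(1)] tendsto_diff[OF X'(2) that(2)]]) simp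
    then show ?thesis by simp
  qed
  obtain W where W: "\<forall>x. W \<rhd> x = F x"
  proof (atomize_elim, rule bop_exists[where K = 1])
    fix x y c
    obtain X Y where X: "X \<longlonglongrightarrow> x" "Y \<longlonglongrightarrow> F x" "\<And>n. (X n, Y n) \<in> G"
      using F[of x] by (elim exE conjE) (rule that, assumption, assumption, erule spec)
    obtain X' Y' where X': "X' \<longlonglongrightarrow> y" "Y' \<longlonglongrightarrow> F y" "\<And>n. (X' n, Y' n) \<in> G"
      using F[of y] by (elim exE conjE) (rule that, assumption, assumption, erule spec)
    show "F (x + y) = F x + F y"
      using add[OF X(3) X'(3)]
      by (intro uniq[OF tendsto_add[OF X(1) X'(1)] tendsto_add[OF X(2) X'(2)]]) simp
    have "(\<rhd>) (c *\<^sub>C 1) = ((*\<^sub>C) c :: 'h \<Rightarrow> 'h)"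
      by (simp add: fun_eq_iff scaleC_bop_apply bop_apply_one)
    then have "bounded_linear ((*\<^sub>C) c :: 'h \<Rightarrow> 'h)"
      using bounded_linear_bop by metis
    note bl = bounded_linear.tendsto[OF this]
    show "F (c *\<^sub>C x) = c *\<^sub>C F x"
      using scale[OF X(3), of c] by (intro uniq[OF bl[OF X(1)] bl[OF X(2)]]) (simp add: scaleC_prod_def)
    show "norm (F x) \<le> 1 * norm x" using lim[OF X] by simp
  qed
  have "F (g i) = f i" for i
    using complex_vector.span_base[of "h i" "range h"]
    by (intro uniq[OF tendsto_const tendsto_const]) (simp add: G_def h_def)
  with W show ?thesis by (intro exI[of _ W]) simp
qed

text \<open>The column of all \<open>f j\<close> preserves inner products, so the squared norms of
  its entries add up to that of the corresponding combination of the \<open>g i\<close>. Each single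
  entry is therefore contractive and extends.\<close>

lemma ex_bop_column:
  fixes g :: "'i \<Rightarrow> 'h::hilbert_space" and f :: "'j \<Rightarrow> 'i \<Rightarrow> 'h"
  assumes total: "closure (cspan (range g)) = UNIV" and J: "finite J" "j \<in> J"
    and inner: "\<And>i i'. (\<Sum>j\<in>J. cinner (f j i) (f j i')) = cinner (g i) (g i')"
  shows "\<exists>W. \<forall>i. W \<rhd> g i = f j i"
proof (rule ex_bop_extension[OF total])
  fix I :: "'i set" and c :: "'i \<Rightarrow> complex"
  have sq: "complex_of_real ((norm (\<Sum>i\<in>I. c i *\<^sub>C h i))\<^sup>2) =
      (\<Sum>i\<in>I. \<Sum>i'\<in>I. cnj (c i) * c i' * cinner (h i) (h i'))" for h :: "'i \<Rightarrow> 'h"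
    by (simp only: cinner_sum_left cinner_scaleC_left flip: cinner_self)
      (simp add: cinner_sum_right cinner_scaleC_right sum_distrib_left mult.assoc)
  have "complex_of_real (\<Sum>j\<in>J. (norm (\<Sum>i\<in>I. c i *\<^sub>C f j i))\<^sup>2) =
      (\<Sum>j\<in>J. \<Sum>i\<in>I. \<Sum>i'\<in>I. cnj (c i) * c i' * cinner (f j i) (f j i'))"
    by (simp only: of_real_sum sq)
  also have "\<dots> = (\<Sum>i\<in>I. \<Sum>i'\<in>I. cnj (c i) * c i' * (\<Sum>j\<in>J. cinner (f j i) (f j i')))"
    unfolding sum_distrib_left
    by (subst sum.swap, intro sum.cong refl, subst sum.swap, rule refl)
  also have "\<dots> = complex_of_real ((norm (\<Sum>i\<in>I. c i *\<^sub>C g i))\<^sup>2)"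
    by (simp only: inner sq)
  finally have "(\<Sum>j\<in>J. (norm (\<Sum>i\<in>I. c i *\<^sub>C f j i))\<^sup>2) = (norm (\<Sum>i\<in>I. c i *\<^sub>C g i))\<^sup>2"
    by (simp only: of_real_eq_iff)
  moreover have "(norm (\<Sum>i\<in>I. c i *\<^sub>C f j i))\<^sup>2 \<le> (\<Sum>j\<in>J. (norm (\<Sum>i\<in>I. c i *\<^sub>C f j i))\<^sup>2)"
    using J by (intro member_le_sum) auto
  ultimately have "(norm (\<Sum>i\<in>I. c i *\<^sub>C f j i))\<^sup>2 \<le> (norm (\<Sum>i\<in>I. c i *\<^sub>C g i))\<^sup>2"
    by (simp only:)
  then show "norm (\<Sum>i\<in>I. c i *\<^sub>C f j i) \<le> norm (\<Sum>i\<in>I. c i *\<^sub>C g i)"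
    by (rule power2_le_imp_le) (rule norm_ge_zero)
qed

section \<open>Tensor products of Hilbert spaces and operators on elementary tensors\<close>

lemma hilbert_tensor_productD:
  assumes "hilbert_tensor_product t"
  shows hilbert_tensor_cinner: "cinner (t x y) (t x' y') = cinner x x' * cinner y y'"
    and hilbert_tensor_total: "closure (cspan (range (case_prod t))) = UNIV"
    and hilbert_tensor_add_left: "t (x + x') y = t x y + t x' y"
    and hilbert_tensor_scaleC_left: "t (c *\<^sub>C x) y = c *\<^sub>C t x y"
    and hilbert_tensor_sum_left: "t (\<Sum>i\<in>I. f i) y = (\<Sum>i\<in>I. t (f i) y)"
    and hilbert_tensor_add_right: "t x (y + y') = t x y + t x y'"
    and hilbert_tensor_scaleC_right: "t x (c *\<^sub>C y) = c *\<^sub>C t x y"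
proof -
  have lin: "clinear (\<lambda>x. t x y)" "clinear (t x)" for x y
    using assms by (auto simp: hilbert_tensor_product_def)
  show "cinner (t x y) (t x' y') = cinner x x' * cinner y y'"
    using assms by (auto simp: hilbert_tensor_product_def)
  have "range (case_prod t) = {t x y | x y. True}" by auto
  then show "closure (cspan (range (case_prod t))) = UNIV"
    using assms by (auto simp: hilbert_tensor_product_def)
  interpret l: Vector_Spaces.linear scaleC scaleC "\<lambda>x. t x y" by (rule lin)
  interpret r: Vector_Spaces.linear scaleC scaleC "t x" by (rule lin)
  show "t (x + x') y = t x y + t x' y" by (rule l.add)
  show "t (c *\<^sub>C x) y = c *\<^sub>C t x y" by (rule l.scale)
  show "t (\<Sum>i\<in>I. f i) y = (\<Sum>i\<in>I. t (f i) y)" by (rule l.sum)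
  show "t x (y + y') = t x y + t x y'" by (rule r.add)
  show "t x (c *\<^sub>C y) = c *\<^sub>C t x y" by (rule r.scale)
qed

lemma hilbert_tensor_norm:
  assumes "hilbert_tensor_product t"
  shows "norm (t x y) = norm x * norm y"
proof -
  have "complex_of_real ((norm (t x y))\<^sup>2) = complex_of_real ((norm x * norm y)\<^sup>2)"
    unfolding cinner_self[symmetric] hilbert_tensor_cinner[OF assms]
    by (simp add: cinner_self power_mult_distrib)
  then show ?thesis unfolding of_real_eq_iff by (rule power2_eq_imp_eq) simp_all
qed

lemma hilbert_tensor_eqI:
  fixes t :: "'h::hilbert_space \<Rightarrow> 'k::hilbert_space \<Rightarrow> 'hk::hilbert_space"
  assumes t: "hilbert_tensor_product t" and eq: "\<And>x y. cinner \<xi> (t x y) = cinner \<zeta> (t x y)"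
  shows "\<xi> = \<zeta>"
proof (rule cinner_ext)
  fix z :: 'hk
  have "z \<in> closure (cspan (range (case_prod t)))" using hilbert_tensor_total[OF t] by simp
  then show "cinner \<xi> z = cinner \<zeta> z"
    by (induction rule: closure_cspan_induct)
      (auto simp: eq cinner_add_right cinner_scaleC_right intro!: closed_Collect_eq continuous_intros)
qed

text \<open>\<open>bop_tensor\<close> is a definite description. Given a bounded operator with the
  right values, totality of elementary tensors supplies uniqueness.\<close>

lemma bop_tensor_apply:
  fixes t :: "'h::hilbert_space \<Rightarrow> 'k::hilbert_space \<Rightarrow> 'hk::hilbert_space"
  assumes t: "hilbert_tensor_product t" and ex: "\<exists>W. \<forall>x y. W \<rhd> t x y = t (X \<rhd> x) (Y \<rhd> y)"
  shows "bop_tensor t X Y \<rhd> t x y = t (X \<rhd> x) (Y \<rhd> y)"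
proof -
  have "\<exists>!W. \<forall>x y. W \<rhd> t x y = t (X \<rhd> x) (Y \<rhd> y)"
  proof (rule ex_ex1I[OF ex], rule bop_eqI)
    fix W W' z
    assume eq: "\<forall>x y. W \<rhd> t x y = t (X \<rhd> x) (Y \<rhd> y)" "\<forall>x y. W' \<rhd> t x y = t (X \<rhd> x) (Y \<rhd> y)"
    have "z \<in> closure (cspan (range (case_prod t)))" using hilbert_tensor_total[OF t] by simp
    then show "W \<rhd> z = W' \<rhd> z"
    proof (induction rule: closure_cspan_induct)
      case zero
      show ?case by (metis bop_apply_scaleC complex_vector.scale_zero_left)
    qed (auto simp: eq bop_apply_add bop_apply_scaleC intro!: closed_Collect_eq continuous_intros)
  qed
  from theI'[OF this] show ?thesis unfolding bop_tensor_def by blast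
qed

lemma bop_isometry_cinner:
  assumes "star X * X = (1 :: 'h::hilbert_space bop)"
  shows "cinner (X \<rhd> x) (X \<rhd> y) = cinner x y"
  unfolding star_bop_adjoint[symmetric] bop_apply_times[symmetric] assms bop_apply_one ..

text \<open>Boundedness of the tensor product of two general operators is not needed: the columns that
  occur are isometric.\<close>

lemma bop_tensor_column_apply:
  fixes t :: "'h::hilbert_space \<Rightarrow> 'k::hilbert_space \<Rightarrow> 'hk::hilbert_space"
  assumes t: "hilbert_tensor_product t" and X: "star X * X = 1"
    and Y: "finite J" "j \<in> J" "(\<Sum>j\<in>J. star (Y j) * Y j) = 1"
  shows "bop_tensor t X (Y j) \<rhd> t x y = t (X \<rhd> x) (Y j \<rhd> y)"
proof (rule bop_tensor_apply[OF t])
  have col: "(\<Sum>j\<in>J. cinner (Y j \<rhd> y) (Y j \<rhd> y')) = cinner y y'" for y y'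
  proof -
    have "(\<Sum>j\<in>J. cinner (Y j \<rhd> y) (Y j \<rhd> y')) = cinner ((\<Sum>j\<in>J. star (Y j) * Y j) \<rhd> y) y'"
      by (simp add: bop_sum_apply bop_apply_times cinner_sum_left star_bop_adjoint)
    then show ?thesis by (simp add: Y(3) bop_apply_one)
  qed
  \<comment> \<open>Pairs index the total family of elementary tensors. Inner products of images
    factor: isometry of \<open>X\<close> treats the first leg, \<open>col\<close> the
    second.\<close>
  have "\<exists>W. \<forall>p. W \<rhd> case_prod t p = (\<lambda>j (x, y). t (X \<rhd> x) (Y j \<rhd> y)) j p"
    by (rule ex_bop_column[OF hilbert_tensor_total[OF t] Y(1,2)])
      (auto simp: hilbert_tensor_cinner[OF t] bop_isometry_cinner[OF X] col simp flip: sum_distrib_left)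
  then show "\<exists>W. \<forall>x y. W \<rhd> t x y = t (X \<rhd> x) (Y j \<rhd> y)" by auto
qed

lemma star_one: "star 1 = (1 :: 'a::star_algebra)"
  by (metis mult_1 mult_1_right star_mult star_star)

text \<open>If \<sigma> kills \<open>c\<close>, it kills \<open>star c * c\<close>, whose vector
  state at \<Omega> is its value under the faithful state \<tau>.\<close>

lemma gns_faithful_inj:
  assumes "faithful_state \<tau>" "gns_representation \<tau> \<sigma> \<Omega>" "\<sigma> c = 0"
  shows "c = 0"
proof -
  have hom: "star_hom \<sigma>" and \<tau>: "cinner \<Omega> (\<sigma> c \<rhd> \<Omega>) = \<tau> c" for c
    using assms(2) by (auto simp: gns_representation_def)
  have "\<sigma> (star c * c) = 0" using assms(3) by (simp add: star_hom_mult[OF hom])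
  then have "\<tau> (star c * c) = cinner \<Omega> (0 \<rhd> \<Omega>)" unfolding \<tau>[symmetric] by simp
  also have "0 \<rhd> \<Omega> = 0" using bop_apply_plus[of 0 0 \<Omega>] by simp
  finally show ?thesis using assms(1) by (simp add: faithful_state_def)
qed

section \<open>The space of infinite paths\<close>

lemma cylinder_iff: "\<omega> \<in> cylinder w \<longleftrightarrow> map \<omega> [0..<length w] = w"
  unfolding cylinder_def by (subst list_eq_iff_nth_eq) simp

lemma cylinder_Nil: "cylinder [] = UNIV"
  by (simp add: cylinder_def)

lemma open_cylinder: "open (cylinder w :: (nat \<Rightarrow> 'e::discrete_topology) set)"
proof -
  have "finite {i. (if i < length w then {w ! i} else UNIV) \<noteq> UNIV}"
    by (rule finite_subset[of _ "{..<length w}"]) auto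
  then have "open (Pi\<^sub>E UNIV (\<lambda>i. if i < length w then {w ! i} else UNIV))"
    by (intro open_PiE Topological_Spaces.open_discrete)
  moreover have "Pi\<^sub>E UNIV (\<lambda>i. if i < length w then {w ! i} else UNIV) = cylinder w"
    unfolding cylinder_def set_eq_iff PiE_UNIV_domain Pi_iff by simp
  ultimately show ?thesis by simp
qed

text \<open>Two cylinders are nested or disjoint, according to whether the shorter word is a prefix
  of the longer. Adjoining the empty set gives an intersection-stable generator.\<close>

lemma cylinder_Int: "cylinder u \<inter> cylinder v \<in> insert {} (range cylinder)"
proof -
  have le: "cylinder u \<inter> cylinder v \<in> insert {} (range cylinder)"
    if len: "length u \<le> length v" for u v :: "'a list"
  proof -
    have "\<omega> \<in> cylinder u \<longleftrightarrow> take (length u) v = u" if "\<omega> \<in> cylinder v" for \<omega>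
    proof -
      have "take (length u) v = take (length u) (map \<omega> [0..<length v])"
        using that by (simp only: cylinder_iff)
      also have "\<dots> = map \<omega> [0..<length u]" using len by (simp add: take_map take_upt)
      finally show ?thesis by (simp only: cylinder_iff)
    qed
    then have "cylinder u \<inter> cylinder v = (if take (length u) v = u then cylinder v else {})"
      by (cases "take (length u) v = u") auto
    then show ?thesis by simp
  qed
  show ?thesis
  proof (cases "length u \<le> length v")
    case False
    then have "cylinder v \<inter> cylinder u \<in> insert {} (range cylinder)" by (intro le) simp
    then show ?thesis by (subst Int_commute)
  qed (rule le)
qed

text \<open>A basic open set of the product topology restricts finitely many coordinates; a prefix
  of \<omega> long enough to cover them all fixes these coordinates.\<close>

lemma ex_cylinder_subset_open:
  fixes U :: "(nat \<Rightarrow> 'e::discrete_topology) set"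
  assumes "open U" "\<omega> \<in> U"
  shows "\<exists>w. \<omega> \<in> cylinder w \<and> cylinder w \<subseteq> U"
proof -
  have "openin (product_topology (\<lambda>i. euclidean) UNIV) U" using assms(1) unfolding open_fun_def .
  from product_topology_open_contains_basis[OF this assms(2)] obtain X
    where X: "\<omega> \<in> Pi\<^sub>E UNIV X" "finite {i. X i \<noteq> UNIV}" "Pi\<^sub>E UNIV X \<subseteq> U"
    unfolding topspace_euclidean by (elim exE conjE) (rule that)
  obtain N where N: "\<forall>i\<in>{i. X i \<noteq> UNIV}. i < N"
    using X(2) unfolding finite_nat_set_iff_bounded by (rule exE)
  have "cylinder (map \<omega> [0..<N]) \<subseteq> Pi\<^sub>E UNIV X"
  proof (rule subsetI)
    fix \<eta> assume \<eta>: "\<eta> \<in> cylinder (map \<omega> [0..<N])"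
    have "\<eta> i \<in> X i" for i
    proof (cases "i < N")
      case True
      then have "\<eta> i = \<omega> i" using \<eta> by (simp add: cylinder_def)
      then show ?thesis using X(1) by (simp add: PiE_iff)
    next
      case False
      then show ?thesis using N by auto
    qed
    then show "\<eta> \<in> Pi\<^sub>E UNIV X" by (simp add: PiE_iff)
  qed
  moreover have "\<omega> \<in> cylinder (map \<omega> [0..<N])" by (simp add: cylinder_def)
  ultimately show ?thesis using X(3) by blast
qed

text \<open>There are only countably many words, so every open set is a countable union of
  cylinders.\<close>

lemma sets_borel_cylinder:
  "sets borel = sigma_sets UNIV (insert {} (range (cylinder :: 'e::{finite,discrete_topology} list \<Rightarrow> _)))"
  unfolding sets_borel
proof (rule sigma_sets_eqI)
  fix A :: "(nat \<Rightarrow> 'e) set" assume "A \<in> insert {} (range cylinder)"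
  then have "open A" using open_cylinder by blast
  then show "A \<in> sigma_sets UNIV {S. open S}" by (intro sigma_sets.Basic) simp
next
  fix U :: "(nat \<Rightarrow> 'e) set" assume "U \<in> {S. open S}"
  then have "open U" by simp
  have U: "U = \<Union> (cylinder ` {w. cylinder w \<subseteq> U})"
  proof (rule antisym)
    show "U \<subseteq> \<Union> (cylinder ` {w. cylinder w \<subseteq> U})"
      using ex_cylinder_subset_open[OF \<open>open U\<close>] by blast
  qed blast
  have "\<Union> (cylinder ` {w. cylinder w \<subseteq> U}) \<in>
      sigma_sets UNIV (insert {} (range (cylinder :: 'e list \<Rightarrow> _)))"
  proof (rule sigma_sets_UNION)
    show "countable (cylinder ` {w. cylinder w \<subseteq> U})" by simp
    show "A \<in> sigma_sets UNIV (insert {} (range cylinder))" if "A \<in> cylinder ` {w. cylinder w \<subseteq> U}" for A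
      using that by (intro sigma_sets.Basic) blast
  qed
  with U show "U \<in> sigma_sets UNIV (insert {} (range (cylinder :: 'e list \<Rightarrow> _)))" by simp
qed

text \<open>Dynkin argument: the measurable sets over which \<open>f\<close> integrates to 0 are
  closed under complements and countable disjoint unions, so they comprise all Borel sets.\<close>

lemma AE_zero_if_cylinder_integrals_zero:
  fixes M :: "(nat \<Rightarrow> 'e::{finite,discrete_topology}) measure" and f :: "_ \<Rightarrow> real"
  assumes sets: "sets M = sets borel" and f: "integrable M f"
    and zero: "\<And>w. (LINT \<omega>:cylinder w|M. f \<omega>) = 0"
  shows "AE \<omega> in M. f \<omega> = 0"
proof -
  let ?G = "insert {} (range (cylinder :: 'e list \<Rightarrow> _))"
  have space: "space M = UNIV" using sets_eq_imp_space_eq[OF sets] by simp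
  have sets_G: "sets M = sigma_sets UNIV ?G" by (simp add: sets sets_borel_cylinder)
  have int: "set_integrable M A f" if "A \<in> sets M" for A
    unfolding set_integrable_def by (rule integrable_mult_indicator[OF that f])
  have stable: "Int_stable ?G"
    using cylinder_Int unfolding Int_stable_def by blast
  have "(LINT \<omega>:A|M. f \<omega>) = 0" if "A \<in> sigma_sets UNIV ?G" for A
    using stable subset_UNIV[of ?G, folded Pow_UNIV] that
  proof (induction A rule: sigma_sets_induct_disjoint)
    case (basic A)
    then show ?case using zero by (auto simp: set_lebesgue_integral_def)
  next
    case empty
    show ?case by (simp add: set_lebesgue_integral_def)
  next
    case (compl A)
    then have A: "A \<in> sets M" by (simp only: sets_G)
    then have "UNIV - A \<in> sets M" using sets.compl_sets[OF A] by (simp only: space)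
    with A have "(LINT \<omega>:A \<union> (UNIV - A)|M. f \<omega>) = (LINT \<omega>:A|M. f \<omega>) + (LINT \<omega>:UNIV - A|M. f \<omega>)"
      by (intro set_integral_Un int) auto
    \<comment> \<open>The empty word gives the whole space, so the total integral is 0 as
      well.\<close>
    then show ?case using zero[of "[]"] compl.IH by (simp add: cylinder_Nil)
  next
    case (union A)
    have A: "A i \<in> sets M" for i using union.hyps(2) unfolding sets_G by blast
    have "(LINT \<omega>:(\<Union>i. A i)|M. f \<omega>) = suminf (\<lambda>i. LINT \<omega>:A i|M. f \<omega>)"
    proof (rule lebesgue_integral_countable_add[OF A])
      show "A i \<inter> A j = {}" if "i \<noteq> j" for i j
        using union.hyps(1) that unfolding disjoint_family_on_def by blast
      show "set_integrable M (\<Union>i. A i) f"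
        using A by (intro int sets.countable_UN) blast
    qed
    also have "\<dots> = 0" by (simp only: union.IH suminf_zero)
    finally show ?case .
  qed
  then have "(LINT \<omega>:A|M. f \<omega>) = (LINT \<omega>:A|M. 0)" if "A \<in> sets M" for A
    using that[unfolded sets_G] by (simp add: set_lebesgue_integral_def)
  then show ?thesis by (rule density_unique_real[OF f integrable_zero])
qed

section \<open>Cylinder functions in the Hilbert space of square-integrable functions\<close>

locale path_L2 = prob_space M
  for M :: "(nat \<Rightarrow> 'e::{finite,discrete_topology}) measure" +
  fixes cls :: "((nat \<Rightarrow> 'e) \<Rightarrow> complex) \<Rightarrow> 'h::hilbert_space"
  assumes sets_M: "sets M = sets borel" and L2: "L2_space M cls"
begin

abbreviation cyl_vec :: "'e list \<Rightarrow> 'h" where "cyl_vec w \<equiv> cls (indicator (cylinder w))"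
abbreviation path_space :: "int \<Rightarrow> 'h set" where "path_space \<equiv> path_subspace cls"

lemma cylinder_measurable: "cylinder w \<in> sets M"
  unfolding sets_M by (rule borel_open) (rule open_cylinder)

lemma space_M: "space M = UNIV"
  using sets_eq_imp_space_eq[OF sets_M] by simp

lemma indicator_square_integrable: "indicator (cylinder w) \<in> square_integrable M"
proof -
  have ind: "(\<lambda>\<omega>. (cmod (indicator (cylinder w) \<omega>))\<^sup>2) = (indicator (cylinder w) :: _ \<Rightarrow> real)"
    by (auto simp: indicator_def)
  have "integrable M (indicator (cylinder w) :: _ \<Rightarrow> real)"
    using cylinder_measurable by (intro integrable_real_indicator) (auto simp: less_top[symmetric])
  then show ?thesis
    using cylinder_measurable unfolding square_integrable_def mem_Collect_eq ind
    by (intro conjI borel_measurable_indicator)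
qed

lemma cinner_cls:
  "f \<in> square_integrable M \<Longrightarrow> g \<in> square_integrable M \<Longrightarrow>
    cinner (cls f) (cls g) = (LINT \<omega>|M. cnj (f \<omega>) * g \<omega>)"
  using L2 unfolding L2_space_def by blast

lemma cinner_cyl_vec: "cinner (cyl_vec u) (cyl_vec v) = of_real (prob (cylinder u \<inter> cylinder v))"
proof -
  have "cinner (cyl_vec u) (cyl_vec v) =
      (LINT \<omega>|M. complex_of_real (indicator (cylinder u \<inter> cylinder v) \<omega>))"
    unfolding cinner_cls[OF indicator_square_integrable indicator_square_integrable]
    by (intro Bochner_Integration.integral_cong) (auto simp: indicator_def)
  also have "\<dots> = of_real (prob (cylinder u \<inter> cylinder v))"
    by (simp add: space_M)
  finally show ?thesis .
qed

text \<open>Orthogonality to the cylinder functions says that a representative integrates to 0 over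
  every cylinder; its real and imaginary parts then vanish almost everywhere.\<close>

lemma cyl_vec_total:
  assumes orth: "\<And>w. cinner (cyl_vec w) x = 0"
  shows "x = 0"
proof -
  have "x \<in> cls ` square_integrable M" using L2 by (simp add: L2_space_def)
  then obtain f where f: "f \<in> square_integrable M" "x = cls f" by (rule imageE)
  have meas: "f \<in> borel_measurable M" and sq: "integrable M (\<lambda>\<omega>. (cmod (f \<omega>))\<^sup>2)"
    using f(1) by (auto simp: square_integrable_def)
  \<comment> \<open>On a probability space square-integrability implies integrability, by
    \<open>r \<le> 1 + r\<^sup>2\<close>.\<close>
  have int: "integrable M f"
  proof (rule Bochner_Integration.integrable_bound)
    show "integrable M (\<lambda>\<omega>. 1 + (cmod (f \<omega>))\<^sup>2)" using sq by (intro Bochner_Integration.integrable_add) simp_all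
    have "r \<le> 1 + r\<^sup>2" for r :: real
    proof -
      have "(r - 1)\<^sup>2 = r\<^sup>2 - 2 * r + 1" by (simp add: power2_eq_square algebra_simps)
      then show ?thesis using zero_le_power2[of "r - 1"] zero_le_power2[of r] by linarith
    qed
    then show "AE \<omega> in M. norm (f \<omega>) \<le> norm (1 + (cmod (f \<omega>))\<^sup>2)"
      by (intro AE_I2) (simp add: abs_of_nonneg)
  qed (rule meas)
  have cyl: "(LINT \<omega>|M. indicator (cylinder w) \<omega> *\<^sub>R f \<omega>) = 0" for w
  proof -
    have "(LINT \<omega>|M. indicator (cylinder w) \<omega> *\<^sub>R f \<omega>) = cinner (cyl_vec w) x"
      unfolding f(2) cinner_cls[OF indicator_square_integrable f(1)]
      by (intro Bochner_Integration.integral_cong) (auto simp: indicator_def)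
    then show ?thesis by (simp add: orth)
  qed
  have cyl_int: "integrable M (\<lambda>\<omega>. indicator (cylinder w) \<omega> *\<^sub>R f \<omega>)" for w
    by (rule integrable_mult_indicator[OF cylinder_measurable int])
  have "AE \<omega> in M. Re (f \<omega>) = 0"
  proof (rule AE_zero_if_cylinder_integrals_zero[OF sets_M])
    show "integrable M (\<lambda>\<omega>. Re (f \<omega>))" using int by (rule integrable_Re)
    show "(LINT \<omega>:cylinder w|M. Re (f \<omega>)) = 0" for w
      using integral_Re[OF cyl_int[of w]] by (simp add: cyl set_lebesgue_integral_def)
  qed
  moreover have "AE \<omega> in M. Im (f \<omega>) = 0"
  proof (rule AE_zero_if_cylinder_integrals_zero[OF sets_M])
    show "integrable M (\<lambda>\<omega>. Im (f \<omega>))" using int by (rule integrable_Im)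
    show "(LINT \<omega>:cylinder w|M. Im (f \<omega>)) = 0" for w
      using integral_Im[OF cyl_int[of w]] by (simp add: cyl set_lebesgue_integral_def)
  qed
  ultimately have "AE \<omega> in M. cnj (f \<omega>) * f \<omega> = 0"
    by eventually_elim (simp add: complex_eq_iff)
  then have "cinner x x = 0"
    unfolding f(2) cinner_cls[OF f(1) f(1)] by (rule integral_eq_zero_AE)
  then show ?thesis by simp
qed

section \<open>The filtration by path length and its projections\<close>

lemma one_eq_cyl_vec_Nil: "cls (\<lambda>\<omega>. 1) = cyl_vec []"
  by (rule arg_cong[of _ _ cls]) (simp add: fun_eq_iff cylinder_Nil)

lemma path_space_minus_one: "path_space (-1) = cspan {cyl_vec []}"
  by (simp add: path_subspace_def one_eq_cyl_vec_Nil)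

lemma path_space_of_nat: "path_space (int k) = cspan (cyl_vec ` {w. length w \<le> k})"
  by (simp add: path_subspace_def image_Collect)

text \<open>The empty word is the only word of length 0. This collapse makes the first term of the
  series for D vanish.\<close>

lemma path_space_zero: "path_space 0 = path_space (-1)"
  using path_space_of_nat[of 0] by (simp add: path_space_minus_one)

text \<open>A finite alphabet has finitely many words of bounded length, so projections exist. The
  index \<open>int k - 1\<close> lets a natural number \<open>k\<close> cover the level -1
  too.\<close>

lemma path_space_finite_span: "\<exists>B. finite B \<and> path_space (int k - 1) = cspan B"
proof (cases k)
  case 0
  then show ?thesis by (intro exI[of _ "{cyl_vec []}"]) (simp add: path_space_minus_one)
next
  case (Suc m)
  have "finite {w :: 'e list. length w \<le> m}" using finite_lists_length_le[of "UNIV :: 'e set" m] by simp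
  then show ?thesis
    using path_space_of_nat[of m] Suc
    by (intro exI[of _ "cyl_vec ` {w. length w \<le> m}"]) simp
qed

lemma path_space_mono_Suc: "path_space (int k - 1) \<subseteq> path_space (int k)"
proof (cases k)
  case 0
  then show ?thesis by (simp add: path_space_zero)
next
  case (Suc m)
  have "path_space (int m) \<subseteq> path_space (int (Suc m))"
    unfolding path_space_of_nat by (rule complex_vector.span_mono) auto
  then show ?thesis using Suc by simp
qed

lemma path_space_mono: "j \<le> k \<Longrightarrow> path_space (int j - 1) \<subseteq> path_space (int k - 1)"
proof (induction rule: dec_induct)
  case (step m)
  have "path_space (int m - 1) \<subseteq> path_space (int (Suc m) - 1)" using path_space_mono_Suc[of m] by simp
  with step.IH show ?case by (rule subset_trans)
qed simp

lemma cyl_vec_Nil_in_path_space: "cyl_vec [] \<in> path_space (int k - 1)"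
  using path_space_mono[of 0 k] complex_vector.span_base[of "cyl_vec []" "{cyl_vec []}"]
  by (auto simp: path_space_minus_one)

lemma orth_proj_path_space:
  shows orth_proj_in_path_space: "orth_proj (path_space (int k - 1)) x \<in> path_space (int k - 1)"
    and cinner_orth_proj_path_space:
      "v \<in> path_space (int k - 1) \<Longrightarrow> cinner v (orth_proj (path_space (int k - 1)) x) = cinner v x"
proof -
  obtain B where B: "finite B" "path_space (int k - 1) = cspan B" using path_space_finite_span by blast
  show "orth_proj (path_space (int k - 1)) x \<in> path_space (int k - 1)"
    unfolding B(2) by (rule orth_proj_in_cspan[OF B(1)])
  show "cinner v (orth_proj (path_space (int k - 1)) x) = cinner v x" if "v \<in> path_space (int k - 1)"
    using that unfolding B(2) by (rule cinner_orth_proj[OF B(1)])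
qed

lemma subspace_path_space: "complex_vector.subspace (path_space (int k - 1))"
  using path_space_finite_span[of k] complex_vector.subspace_span by metis

section \<open>Matrix coefficients of the Dirac operator\<close>

text \<open>Pairing with \<open>v\<close> is continuous, so the vector series becomes a scalar one.
  Both projections are put in the form \<open>int k - 1\<close> of the projection lemmas.\<close>

lemma dirac_cinner_sums:
  assumes "(x, y) \<in> dirac cls a"
  shows "(\<lambda>p. of_real (a p) * (cinner v (orth_proj (path_space (int (Suc p) - 1)) x)
    - cinner v (orth_proj (path_space (int p - 1)) x))) sums cinner v y"
proof -
  have "(\<lambda>p. a p *\<^sub>R (orth_proj (path_space (int p)) x - orth_proj (path_space (int p - 1)) x)) sums y"
    using assms by (simp add: dirac_def)
  from bounded_linear.sums[OF bounded_linear_cinner this, of v] show ?thesis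
    by (simp add: cinner_scaleR_right cinner_diff_right)
qed

text \<open>Pairing \<open>v\<close> with the projections of \<open>x\<close> gives 0 below level
  \<open>q\<close> and \<open>cinner v x\<close> from level \<open>q\<close> on, so only the term
  \<open>q\<close> survives. For \<open>q = 0\<close> the assumptions force
  \<open>v = 0\<close>.\<close>

lemma dirac_eigenvector:
  assumes xy: "(x, y) \<in> dirac cls a" and v: "v \<in> path_space (int q)"
    and orth: "\<And>u. u \<in> path_space (int q - 1) \<Longrightarrow> cinner v u = 0"
  shows "cinner v y = of_real (a q) * cinner v x"
proof -
  have proj: "cinner v (orth_proj (path_space (int p - 1)) x) = (if p \<le> q then 0 else cinner v x)" for p
  proof (cases "p \<le> q")
    case True
    then show ?thesis
      using orth path_space_mono[OF True] orth_proj_in_path_space[of p x] by auto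
  next
    case False
    then have "v \<in> path_space (int p - 1)" using v path_space_mono[of "Suc q" p] by auto
    then show ?thesis using False by (simp only: cinner_orth_proj_path_space if_False)
  qed
  have "(\<lambda>p. if p = q then of_real (a p) * cinner v x else 0) sums cinner v y"
    using dirac_cinner_sums[OF xy, of v] unfolding proj
    by (rule back_subst[of "\<lambda>f. f sums cinner v y"]) (auto simp: fun_eq_iff)
  then show ?thesis using sums_single[of q "\<lambda>p. of_real (a p) * cinner v x"] sums_unique2 by metis
qed

text \<open>Constants lie in every level, so their pairing with the projections of \<open>x\<close>
  does not change from level to level, and all increments are 0.\<close>

lemma dirac_orthogonal_one:
  assumes xy: "(x, y) \<in> dirac cls a"
  shows "cinner (cyl_vec []) y = 0"
proof -
  have "(\<lambda>p. 0) sums cinner (cyl_vec []) y"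
    using dirac_cinner_sums[OF xy, of "cyl_vec []"]
    by (simp only: cinner_orth_proj_path_space[OF cyl_vec_Nil_in_path_space]) simp
  then show ?thesis using sums_zero sums_unique2 by metis
qed

lemma dirac_one: "(cyl_vec [], 0) \<in> dirac cls a"
proof -
  have "orth_proj (path_space (int k - 1)) (cyl_vec []) = cyl_vec []" for k
  proof -
    obtain B where B: "path_space (int k - 1) = cspan B" using path_space_finite_span by blast
    show ?thesis
      unfolding B using cyl_vec_Nil_in_path_space[of k] by (intro orth_proj_eqI) (auto simp: B)
  qed
  from this[of "Suc _"] this show ?thesis by (simp add: dirac_def)
qed

lemma cinner_cyl_vec_Nil: "cinner (cyl_vec []) (cyl_vec []) = 1"
  unfolding cinner_cyl_vec using prob_space by (simp add: space_M cylinder_Nil)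

section \<open>The kernel of D tensor 1 and its invariance under commuting unitaries\<close>

text \<open>For fixed \<open>y\<close>, the functional of \<open>x\<close> on the right of
  \<open>cinner \<xi>\<close> is represented by a vector \<open>z\<close>. By assumption
  \<open>z\<close> is orthogonal to every increment of the filtration above level 0, so by totality
  \<open>z\<close> is a multiple of the constant function.\<close>

lemma functional_one_tensor:
  fixes t :: "'h \<Rightarrow> 'k::hilbert_space \<Rightarrow> 'hk::hilbert_space"
  assumes t: "hilbert_tensor_product t"
    and orth: "\<And>q v y. q > 0 \<Longrightarrow> v \<in> path_space (int q) \<Longrightarrow>
      (\<And>u. u \<in> path_space (int q - 1) \<Longrightarrow> cinner v u = 0) \<Longrightarrow> cinner (t v y) \<xi> = 0"
  shows "cinner \<xi> (t x y) = cinner (cyl_vec []) x * cinner \<xi> (t (cyl_vec []) y)"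
proof -
  let ?e = "cyl_vec []"
  obtain z where z: "\<And>x. cinner z x = cinner \<xi> (t x y)"
  proof (atomize_elim, rule riesz_representation[where K = "norm \<xi> * norm y"])
    show "cmod (cinner \<xi> (t x y)) \<le> norm \<xi> * norm y * norm x" for x
      using cinner_Cauchy_Schwarz[of \<xi> "t x y"] by (simp add: hilbert_tensor_norm[OF t] ac_simps)
  qed (simp_all add: hilbert_tensor_add_left[OF t] hilbert_tensor_scaleC_left[OF t]
      cinner_add_right cinner_scaleC_right)
  \<comment> \<open>The part of \<open>z\<close> orthogonal to the constants; induction on the level
    shows that it is orthogonal to all cylinder functions.\<close>
  define z' where "z' = z - cinner ?e z *\<^sub>C ?e"
  have e: "cinner ?e z' = 0"
    by (simp add: z'_def cinner_diff_right cinner_scaleC_right cinner_cyl_vec_Nil)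
  have "cinner v z' = 0" if "v \<in> path_space (int q)" for v q
    using that
  proof (induction q arbitrary: v)
    case 0
    then have "v \<in> cspan {?e}" by (simp add: path_space_zero path_space_minus_one)
    then show ?case by (rule cinner_orthogonal_cspan[rotated]) (simp add: e)
  next
    case (Suc q)
    \<comment> \<open>Here \<open>p\<close> is the part of \<open>v\<close> in level
      \<open>q\<close>, handled by induction, and \<open>v - p\<close> is orthogonal to that level,
      where \<open>orth\<close> applies.\<close>
    define p where "p = orth_proj (path_space (int (Suc q) - 1)) v"
    have p: "p \<in> path_space (int q)" using orth_proj_in_path_space[of "Suc q" v] by (simp add: p_def)
    have "p \<in> path_space (int (Suc q))" using p path_space_mono_Suc[of "Suc q"] by auto
    then have mem: "v - p \<in> path_space (int (Suc q))"
      using Suc.prems complex_vector.subspace_diff[OF subspace_path_space[of "Suc (Suc q)"]] by simp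
    have orth': "cinner (v - p) u = 0" if "u \<in> path_space (int (Suc q) - 1)" for u
    proof -
      have "cinner u (v - p) = 0"
        using cinner_orth_proj_path_space[OF that, of v] by (simp add: p_def cinner_diff_right)
      then show ?thesis by (simp only: cinner_eq_0_commute[of u])
    qed
    have "cinner (t (v - p) y) \<xi> = 0" by (rule orth[OF zero_less_Suc mem orth'])
    then have "cinner (v - p) z = 0" using z[of "v - p"] by (metis cinner_eq_0_commute)
    moreover have "cinner (v - p) ?e = 0" by (rule orth'[OF cyl_vec_Nil_in_path_space])
    ultimately have "cinner (v - p) z' = 0" by (simp add: z'_def cinner_diff_right cinner_scaleC_right)
    moreover have "cinner p z' = 0" by (rule Suc.IH[OF p])
    ultimately show ?case by (simp add: cinner_diff_left)
  qed
  moreover have "cyl_vec w \<in> path_space (int (length w))" for w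
    unfolding path_space_of_nat by (rule complex_vector.span_base) simp
  ultimately have "z' = 0" by (intro cyl_vec_total) blast
  then have "z = cinner ?e z *\<^sub>C ?e" by (simp add: z'_def)
  then have "cinner z x = cinner z ?e * cinner ?e x"
    by (metis cinner_scaleC_left cinner_commute)
  then show ?thesis by (simp add: z)
qed

text \<open>The identity is linear and closed in the pair, and on generators it factors into the one
  for \<open>D\<close>; hence it passes to the closed graph.\<close>

lemma tensor_one_cinner:
  assumes t: "hilbert_tensor_product t" and "(\<xi>, \<zeta>) \<in> tensor_one t D"
    and D: "\<And>x x'. (x, x') \<in> D \<Longrightarrow> cinner v x' = c * cinner v x"
  shows "cinner (t v y) \<zeta> = c * cinner (t v y) \<xi>"
proof -
  have "cinner (t v y) (snd p) = c * cinner (t v y) (fst p)" if "p \<in> tensor_one t D" for p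
    using that unfolding tensor_one_def
  proof (induction rule: closure_cspan_induct)
    case (generator p)
    then show ?case by (auto simp: hilbert_tensor_cinner[OF t] D)
  next
    case closed
    show ?case by (intro closed_Collect_eq continuous_intros)
  qed (simp_all add: cinner_add_right cinner_scaleC_right scaleC_prod_def algebra_simps)
  from this[OF assms(2)] show ?thesis by simp
qed

text \<open>Since the eigenvalues are positive, \<xi> is orthogonal to all increments, so its
  pairing with \<open>t x y\<close> depends on \<open>x\<close> only through the constant component.
  Riesz representation in the second leg provides \<open>y\<close>.\<close>

lemma kernel_tensor_one_dirac:
  fixes t :: "'h \<Rightarrow> 'k::hilbert_space \<Rightarrow> 'hk::hilbert_space"
  assumes t: "hilbert_tensor_product t" and a: "\<And>m. a m > 0"
    and \<xi>: "(\<xi>, 0) \<in> tensor_one t (dirac cls a)"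
  shows "\<exists>y. \<xi> = t (cyl_vec []) y"
proof -
  let ?e = "cyl_vec []"
  have orth: "cinner (t v y) \<xi> = 0" if "v \<in> path_space (int q)"
    "\<And>u. u \<in> path_space (int q - 1) \<Longrightarrow> cinner v u = 0" for q v y
  proof -
    have "cinner (t v y) 0 = of_real (a q) * cinner (t v y) \<xi>"
      by (rule tensor_one_cinner[OF t \<xi>]) (rule dirac_eigenvector[OF _ that])
    then show ?thesis using a[of q] by simp
  qed
  have eq: "cinner \<xi> (t x y) = cinner ?e x * cinner \<xi> (t ?e y)" for x y
  proof (rule functional_one_tensor[OF t])
    show "cinner (t v y) \<xi> = 0" if "q > 0" "v \<in> path_space (int q)"
      "\<And>u. u \<in> path_space (int q - 1) \<Longrightarrow> cinner v u = 0" for q v y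
      by (rule orth[OF that(2,3)])
  qed
  have "complex_of_real ((norm ?e)\<^sup>2) = complex_of_real 1"
    unfolding cinner_self[symmetric] by (simp add: cinner_cyl_vec_Nil)
  then have norm_e: "norm ?e = 1"
    unfolding of_real_eq_iff by (metis norm_ge_zero one_power2 power2_eq_imp_eq zero_le_one)
  have "\<exists>y0. \<forall>y. cinner y0 y = cinner \<xi> (t ?e y)"
  proof (rule riesz_representation[where K = "norm \<xi>"])
    show "cmod (cinner \<xi> (t ?e y)) \<le> norm \<xi> * norm y" for y
      using cinner_Cauchy_Schwarz[of \<xi> "t ?e y"] norm_e by (simp add: hilbert_tensor_norm[OF t])
  qed (simp_all add: hilbert_tensor_add_right[OF t] hilbert_tensor_scaleC_right[OF t]
      cinner_add_right cinner_scaleC_right)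
  then obtain y0 where y0: "\<And>y. cinner y0 y = cinner \<xi> (t ?e y)" by blast
  have "\<xi> = t ?e y0"
    by (rule hilbert_tensor_eqI[OF t], unfold hilbert_tensor_cinner[OF t] y0) (rule eq)
  then show ?thesis ..
qed

text \<open>As \<open>tensor_one\<close> is a relation, uniqueness of the value needs proof.
  Increments above level 0 are orthogonal to the constants, so \<zeta> has no component there; its
  constant component vanishes because D maps into the complement of the constants.\<close>

lemma tensor_one_dirac_single_valued_at_one:
  fixes t :: "'h \<Rightarrow> 'k::hilbert_space \<Rightarrow> 'hk::hilbert_space"
  assumes t: "hilbert_tensor_product t"
    and T: "(t (cyl_vec []) y, \<zeta>) \<in> tensor_one t (dirac cls a)"
  shows "\<zeta> = 0"
proof (rule hilbert_tensor_eqI[OF t])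
  fix x y'
  have "cinner \<zeta> (t x y') = cinner (cyl_vec []) x * cinner \<zeta> (t (cyl_vec []) y')"
  proof (rule functional_one_tensor[OF t])
    fix q v y'
    assume "q > 0" and v: "v \<in> path_space (int q)"
      "\<And>u. u \<in> path_space (int q - 1) \<Longrightarrow> cinner v u = 0"
    have "cinner (t v y') \<zeta> = of_real (a q) * cinner (t v y') (t (cyl_vec []) y)"
      by (rule tensor_one_cinner[OF t T]) (rule dirac_eigenvector[OF _ v])
    then show "cinner (t v y') \<zeta> = 0"
      by (simp add: hilbert_tensor_cinner[OF t] v(2)[OF cyl_vec_Nil_in_path_space])
  qed
  moreover have "cinner (t (cyl_vec []) y') \<zeta> = 0 * cinner (t (cyl_vec []) y') (t (cyl_vec []) y)"
    by (rule tensor_one_cinner[OF t T]) (simp add: dirac_orthogonal_one)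
  then have "cinner \<zeta> (t (cyl_vec []) y') = 0" using cinner_eq_0_commute by fastforce
  ultimately show "cinner \<zeta> (t x y') = cinner 0 (t x y')" by simp
qed

text \<open>\<open>U\<close> maps the domain onto itself, so \<open>t (cyl_vec []) y\<close> has a
  preimage \<xi> with some value \<zeta>. Commutation sends \<zeta> to the value at the image, which
  is 0; \<open>U\<close> is injective, so \<xi> lies in the kernel.\<close>

lemma commuting_isometry_one_tensor:
  fixes t :: "'h \<Rightarrow> 'k::hilbert_space \<Rightarrow> 'hk::hilbert_space"
  assumes t: "hilbert_tensor_product t" and a: "\<And>m. a m > 0"
    and U: "commutes_with_unbounded U (tensor_one t (dirac cls a))" and iso: "star U * U = 1"
  shows "\<exists>y'. U \<rhd> t (cyl_vec []) y' = t (cyl_vec []) y"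
proof -
  let ?T = "tensor_one t (dirac cls a)" and ?e = "cyl_vec []"
  have t0: "t 0 y = 0" using hilbert_tensor_scaleC_left[OF t, of 0 0 y] by simp
  have "(t ?e y, t 0 y) \<in> ?T"
    unfolding tensor_one_def using dirac_one
    by (intro subsetD[OF closure_subset] complex_vector.span_base) blast
  then have "t ?e y \<in> Domain ?T" by (rule DomainI)
  then have "t ?e y \<in> (\<rhd>) U ` Domain ?T" using U by (simp add: commutes_with_unbounded_def)
  then obtain \<xi> \<zeta> where \<xi>: "U \<rhd> \<xi> = t ?e y" "(\<xi>, \<zeta>) \<in> ?T" by auto
  have "(U \<rhd> \<xi>, U \<rhd> \<zeta>) \<in> ?T" using U \<xi>(2) unfolding commutes_with_unbounded_def by blast
  then have "U \<rhd> \<zeta> = 0" unfolding \<xi>(1) by (rule tensor_one_dirac_single_valued_at_one[OF t])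
  then have "\<zeta> = 0" using bop_isometry_cinner[OF iso, of \<zeta> \<zeta>] by simp
  then have "\<exists>y'. \<xi> = t ?e y'" using \<xi>(2) by (intro kernel_tensor_one_dirac[OF t a]) simp
  then obtain y' where "\<xi> = t ?e y'" by (rule exE)
  with \<xi>(1) show ?thesis by blast
qed

end

section \<open>Row sums of q forced by a commuting implementing unitary\<close>

theorem theorem4p1:
  fixes S :: "'e::{finite,discrete_topology} \<Rightarrow> 'a::cstar_algebra"
    and q :: "'e \<times> 'e \<Rightarrow> 'c::cstar_algebra"
    and tAC :: "'a \<Rightarrow> 'c \<Rightarrow> 'ac::cstar_algebra"
    and tCC :: "'c \<Rightarrow> 'c \<Rightarrow> 'cc::cstar_algebra"
    and \<Delta> :: "'c \<Rightarrow> 'cc"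
    and \<alpha> :: "'a \<Rightarrow> 'ac"
    and M :: "(nat \<Rightarrow> 'e) measure"
    and cls :: "((nat \<Rightarrow> 'e) \<Rightarrow> complex) \<Rightarrow> 'h::hilbert_space"
    and \<pi> :: "'a \<Rightarrow> 'h bop"
    and a :: "nat \<Rightarrow> real"
    and \<tau> :: "'c \<Rightarrow> complex"
    and \<sigma> :: "'c \<Rightarrow> 'k::hilbert_space bop"
    and \<Omega> :: 'k
    and tHK :: "'h \<Rightarrow> 'k \<Rightarrow> 'hk::hilbert_space"
    and tKK :: "'k \<Rightarrow> 'k \<Rightarrow> 'kk::hilbert_space"
    and tHKK :: "'h \<Rightarrow> 'kk \<Rightarrow> 'hkk::hilbert_space"
  assumes n: "CARD('e) \<ge> 2"
    and O_n: "universal_cstar_algebra cuntz_relations S"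
    and U_n: "universal_cstar_algebra free_unitary_relations q"
    and AC: "minimal_tensor_product tAC"
    and CC: "minimal_tensor_product tCC"
    and \<Delta>: "star_hom \<Delta>" "\<And>i j. \<Delta> (q (i, j)) = (\<Sum>k\<in>UNIV. tCC (q (i, k)) (q (k, j)))"
    and \<alpha>: "star_hom \<alpha>" "\<And>i. \<alpha> (S i) = (\<Sum>j\<in>UNIV. tAC (S j) (q (j, i)))"
    and M: "prob_space M" "sets M = sets borel"
      "\<And>w. measure M (cylinder w) = 1 / real CARD('e) ^ length w"
    and H: "L2_space M cls"
    and \<pi>: "star_hom \<pi>"
      "\<And>w v. \<pi> (prod_list (map S w)) \<rhd> cls (indicator (cylinder v)) =
        (real CARD('e) powr (real (length w) / 2)) *\<^sub>R cls (indicator (cylinder (w @ v)))"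
    and a: "incseq a" "\<And>m. a m > 0" "filterlim a at_top sequentially"
      "bdd_above (range (\<lambda>m. \<bar>a (Suc m) - a m\<bar>))"
    and \<tau>: "faithful_state \<tau>" "gns_representation \<tau> \<sigma> \<Omega>"
    and tensors: "hilbert_tensor_product tHK" "hilbert_tensor_product tKK"
      "hilbert_tensor_product tHKK"
  shows "\<not> isometric_action tAC tCC \<Delta> \<alpha> \<pi> (dirac cls a) \<sigma> tHK tKK tHKK"
proof
  assume "isometric_action tAC tCC \<Delta> \<alpha> \<pi> (dirac cls a) \<sigma> tHK tKK tHKK"
  then obtain U where corep: "unitary_corepresentation tCC \<Delta> \<sigma> tHK tKK tHKK U"
    and impl: "implements tAC \<alpha> \<pi> \<sigma> tHK U"
    and comm: "commutes_with_unbounded U (tensor_one tHK (dirac cls a))"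
    unfolding isometric_action_def by (elim exE conjE) (rule that)
  have U: "star U * U = 1"
    using corep unfolding unitary_corepresentation_def by (elim conjE)
  obtain \<Phi> where \<Phi>: "star_hom \<Phi>" "\<And>a b. \<Phi> (tAC a b) = bop_tensor tHK (\<pi> a) (\<sigma> b)"
      "\<And>a. \<Phi> (\<alpha> a) = U * bop_tensor tHK (\<pi> a) (\<sigma> 1) * star U"
    using impl unfolding implements_def tensor_representation_def by blast
  interpret path_L2 M cls
    using M H by (intro path_L2.intro path_L2_axioms.intro)
  note t = tensors(1)
  let ?e = "cyl_vec []" and ?N = "real CARD('e)"
  \<comment> \<open>The square root of n, the factor in the action of a single generator on the
    constant function.\<close>
  define s where "s = complex_of_real (?N powr (1 / 2))"
  have s0: "s \<noteq> 0" by (simp add: s_def)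
  have \<sigma>: "star_hom \<sigma>" using \<tau>(2) unfolding gns_representation_def by (elim conjE)
  have inner: "cinner (cyl_vec [i]) (cyl_vec [j]) = of_bool (i = j) / of_nat CARD('e)" for i j
  proof -
    have "cylinder [i] \<inter> cylinder [j] = (if i = j then cylinder [i] else {})"
      by (auto simp: cylinder_def)
    then show ?thesis unfolding cinner_cyl_vec using M(3)[of "[j]"] by simp
  qed
  have inner_e: "cinner (cyl_vec [i]) ?e = 1 / of_nat CARD('e)" for i
    unfolding cinner_cyl_vec using M(3)[of "[i]"] by (simp add: cylinder_Nil)
  \<comment> \<open>The one-letter cylinders partition the space. Here the squared norm of the
    difference is computed as 1 - 1 - 1 + 1.\<close>
  have sum_e: "(\<Sum>i\<in>UNIV. cyl_vec [i]) = ?e"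
  proof -
    have inner_e': "cinner ?e (cyl_vec [i]) = 1 / of_nat CARD('e)" for i
      using inner_e[of i] cinner_commute[of ?e "cyl_vec [i]"] by simp
    have "cinner ((\<Sum>i\<in>UNIV. cyl_vec [i]) - ?e) ((\<Sum>i\<in>UNIV. cyl_vec [i]) - ?e) = 0"
      unfolding cinner_diff_left cinner_diff_right cinner_sum_left cinner_sum_right
        inner inner_e inner_e' cinner_cyl_vec_Nil
      by (simp add: of_bool_def if_distrib[of "\<lambda>x. x / _"] cong: if_cong)
    then show ?thesis by simp
  qed
  have \<pi>_e: "\<pi> (S i) \<rhd> ?e = s *\<^sub>C cyl_vec [i]" for i
    using \<pi>(2)[of "[i]" "[]"] by (simp add: s_def scaleR_scaleC)
  have \<pi>_iso: "star (\<pi> (S i)) * \<pi> (S i) = 1" for i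
    using cuntz_isometry[OF O_n, of i]
    by (simp add: star_hom_one[OF \<pi>(1)] flip: star_hom_star[OF \<pi>(1)] star_hom_mult[OF \<pi>(1)])
  have \<sigma>_col: "(\<Sum>j\<in>UNIV. star (\<sigma> (q (j, i))) * \<sigma> (q (j, i))) = 1" for i
    using free_unitary_column[OF U_n, of i]
    by (simp add: star_hom_one[OF \<sigma>] flip: star_hom_star[OF \<sigma>] star_hom_mult[OF \<sigma>] star_hom_sum[OF \<sigma>])
  have tensor_q: "bop_tensor tHK (\<pi> (S j)) (\<sigma> (q (j, i))) \<rhd> tHK x y = tHK (\<pi> (S j) \<rhd> x) (\<sigma> (q (j, i)) \<rhd> y)"
    for i j x y
    by (rule bop_tensor_column_apply[where J = UNIV and Y = "\<lambda>j. \<sigma> (q (j, i))",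
          OF t \<pi>_iso _ UNIV_I \<sigma>_col]) simp
  \<comment> \<open>The identity is an isometric column with one entry.\<close>
  have tensor_1: "bop_tensor tHK (\<pi> (S i)) 1 \<rhd> tHK x y = tHK (\<pi> (S i) \<rhd> x) y" for i x y
    using bop_tensor_column_apply[where J = "{()}" and j = "()" and Y = "\<lambda>_. 1", OF t \<pi>_iso]
    by (simp add: star_one bop_apply_one)
  have row: "(\<Sum>i\<in>UNIV. \<sigma> (q (l, i)) \<rhd> y) = y" for l y
  proof (rule cinner_ext)
    fix z
    \<comment> \<open>Commutation places a preimage of the constant tensor again among the constant
      tensors, so \<open>star U\<close> can be evaluated.\<close>
    obtain y' where y': "U \<rhd> tHK ?e y' = tHK ?e y"
      using commuting_isometry_one_tensor[OF t a(2) comm U] by (rule exE)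
    then have star_U: "star U \<rhd> tHK ?e y = tHK ?e y'"
      using U by (metis bop_apply_one bop_apply_times)
    \<comment> \<open>Both sides are the operator of \<open>\<alpha> (S i)\<close> applied to
      \<open>tHK ?e y\<close>: once by the formula for \<alpha>, once by implementation.\<close>
    have "(\<Sum>j\<in>UNIV. tHK (s *\<^sub>C cyl_vec [j]) (\<sigma> (q (j, i)) \<rhd> y)) = U \<rhd> tHK (s *\<^sub>C cyl_vec [i]) y'" for i
    proof -
      have "(\<Sum>j\<in>UNIV. tHK (s *\<^sub>C cyl_vec [j]) (\<sigma> (q (j, i)) \<rhd> y)) = \<Phi> (\<alpha> (S i)) \<rhd> tHK ?e y"
        by (simp add: \<alpha>(2) star_hom_sum[OF \<Phi>(1)] \<Phi>(2) bop_sum_apply tensor_q \<pi>_e)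
      also have "\<dots> = U \<rhd> tHK (s *\<^sub>C cyl_vec [i]) y'"
        by (simp add: \<Phi>(3) bop_apply_times star_U star_hom_one[OF \<sigma>] tensor_1 \<pi>_e)
      finally show ?thesis .
    qed
    \<comment> \<open>Summing over \<open>i\<close> reassembles the constant function inside
      \<open>U\<close>, whose value at \<open>tHK ?e y'\<close> is known.\<close>
    then have "(\<Sum>i\<in>UNIV. \<Sum>j\<in>UNIV. tHK (s *\<^sub>C cyl_vec [j]) (\<sigma> (q (j, i)) \<rhd> y)) =
        U \<rhd> (\<Sum>i\<in>UNIV. tHK (s *\<^sub>C cyl_vec [i]) y')"
      by (simp add: bop_apply_sum)
    also have "\<dots> = s *\<^sub>C tHK ?e y"
      by (simp add: hilbert_tensor_scaleC_left[OF t] bop_apply_scaleC y' sum_e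
          flip: complex_vector.scale_sum_right hilbert_tensor_sum_left[OF t])
    \<comment> \<open>Orthogonality of the one-letter cylinders leaves only \<open>j = l\<close>;
      the factors \<open>s\<close> and 1/n then cancel.\<close>
    finally have "cinner (s *\<^sub>C tHK ?e y) (tHK (cyl_vec [l]) z) =
        cinner (\<Sum>i\<in>UNIV. \<Sum>j\<in>UNIV. tHK (s *\<^sub>C cyl_vec [j]) (\<sigma> (q (j, i)) \<rhd> y)) (tHK (cyl_vec [l]) z)"
      by (simp only:)
    then have "cinner ?e (cyl_vec [l]) * cinner y z =
        (\<Sum>i\<in>UNIV. \<Sum>j\<in>UNIV. cinner (cyl_vec [j]) (cyl_vec [l]) * cinner (\<sigma> (q (j, i)) \<rhd> y) z)"
      using s0
      by (simp add: hilbert_tensor_scaleC_left[OF t] cinner_sum_left cinner_scaleC_left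
          hilbert_tensor_cinner[OF t] flip: sum_distrib_left)
    moreover have "cinner ?e (cyl_vec [l]) = 1 / of_nat CARD('e)"
      using inner_e[of l] cinner_commute[of ?e "cyl_vec [l]"] by simp
    ultimately show "cinner (\<Sum>i\<in>UNIV. \<sigma> (q (l, i)) \<rhd> y) z = cinner y z"
      by (simp add: inner cinner_sum_left of_bool_def if_distrib[of "\<lambda>x. x / _"]
          if_distrib[of "\<lambda>x. x * _"] flip: sum_divide_distrib cong: if_cong)
  qed
  \<comment> \<open>The GNS representation is injective by faithfulness of \<tau>, so the operator
    identity holds in the algebra itself.\<close>
  have "(\<Sum>i\<in>UNIV. q (l, i)) = 1" for l
  proof -
    have "(\<Sum>i\<in>UNIV. \<sigma> (q (l, i))) = 1"
      by (rule bop_eqI) (simp add: bop_sum_apply row bop_apply_one)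
    then have "\<sigma> ((\<Sum>i\<in>UNIV. q (l, i)) - 1) = 0"
      by (simp add: star_hom_diff[OF \<sigma>] star_hom_sum[OF \<sigma>] star_hom_one[OF \<sigma>])
    then have "(\<Sum>i\<in>UNIV. q (l, i)) - 1 = 0" by (rule gns_faithful_inj[OF \<tau>])
    then show ?thesis by simp
  qed
  then show False using free_unitary_row_sum_neq_one[OF U_n] by blast
qed

end
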